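(* Consider the single-resource loss network with capacity $C$ described in the context: renewal arrivals of rate $0<\lambda<\infty$, i.i.d. resource requirements $\{B_n\}_{n\in\mathbb{Z}}$, and i.i.d. holding times $\{\theta_n\}_{n\in\mathbb{Z}}$ with finite mean. Suppose that $\{B_n,-\infty<n<\infty\}$ are subexponential random variables with finite mean. Then the stationary blocking probability satisfies $$\Pr\left[Q^{(C)}_n+B_n>C\right]\sim \Pr[B>C]\qquad\text{as } C\to\infty .$$
   Context: Model. Requests for resources from a common pool of capacity $C<\infty$ arrive at time points $\{\tau_n,-\infty<n<\infty\}$ forming a renewal process with rate $0<\lambda<\infty$, i.e. the interarrival times $\tau_n-\tau_{n-1}$ are i.i.d. with $\mathbb{E}[\tau_n-\tau_{n-1}]=1/\lambda$. The request arriving at $\tau_n$ requires an amount $B_n$ of the resource. If the currently available (non-engaged) capacity is less than $B_n$, the request is rejected (blocked, lost); otherwise it is accepted and the amount $B_n$ is occupied for a length of time $\theta_n$ starting at $\tau_n$, after which it is released. The sequences $\{B_n\}$ and $\{\theta_n\}$ each consist of i.i.d. random variables, they are mutually independent and independent of $\{\tau_n\}$, and $\mathbb{E}\theta_n<\infty$. The random variable $B$ has the common distribution of the $B_n$. Let $\mathcal{N}^{(C)}_n$ be the set of indices $i<n$ of requests that arrive prior to $\tau_n$, are accepted, and are still active at time $\tau_n$ (i.e. $\theta_i>\tau_n-\tau_i$). The amount of engaged resources found by the arrival at $\tau_n$ is $Q^{(C)}_n=\sum_{i\in\mathcal{N}^{(C)}_n}B_i$; thus request $n$ is blocked exactly when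 $Q^{(C)}_n+B_n>C$. For each $C$ the process $Q^{(C)}_n$ has a unique stationary distribution, and the stationary blocking probability is $\Pr[Q^{(C)}_n+B_n>C]$ computed in the stationary regime. Subexponentiality. A distribution function $F$ of a positive random variable with $F(x)<1$ for all $x>0$ is subexponential ($F\in\mathcal{S}$) if, with $X_1,X_2,\dots$ i.i.d. with distribution $F$ and $\bar F(x)=1-F(x)$, one has $\lim_{x\to\infty}\Pr[X_1+\dots+X_n>x]/\bar F(x)=n$ for some (equivalently all) $n\ge 2$. A random variable is subexponential if its distribution function is. Notation: $a(t)\sim b(t)$ as $t\to t_0$ means $\lim_{t\to t_0}a(t)/b(t)=1$. *)

theory Defs
  imports "HOL-Probability.Probability" "HOL-Library.Landau_Symbols"
begin

definition subexponential :: "real measure \<Rightarrow> bool" where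
  "subexponential D \<longleftrightarrow>
     real_distribution D \<and> (AE x in D. x > 0) \<and> (\<forall>x>0. cdf D x < 1) \<and>
     (\<exists>n\<ge>2. ((\<lambda>x. \<P>(X in (\<Pi>\<^sub>M i\<in>{..<n}. D). (\<Sum>i<n. X i) > x) / (1 - cdf D x))
                \<longlongrightarrow> real n) at_top)"

context prob_space
begin

definition iid :: "('i \<Rightarrow> 'a \<Rightarrow> real) \<Rightarrow> bool" where
  "iid X \<longleftrightarrow> indep_vars (\<lambda>_. borel) X UNIV \<and>
     (\<forall>i j. distr M borel (X i) = distr M borel (X j))"

definition stationary :: "(int \<Rightarrow> 'a \<Rightarrow> real) \<Rightarrow> bool" where
  "stationary X \<longleftrightarrow> (\<forall>n. random_variable borel (X n)) \<and>
     (\<forall>k. distr M (\<Pi>\<^sub>M n\<in>UNIV. borel) (\<lambda>\<omega> n. X (n + k) \<omega>) =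
          distr M (\<Pi>\<^sub>M n\<in>UNIV. borel) (\<lambda>\<omega> n. X n \<omega>))"

end

text \<open>
  Interarrival times are only required to be nonnegative; simultaneous arrivals are served in the
  order of their indices. The last assumption says that the three sequences, taken as random
  elements of the sequence space, are mutually independent.
\<close>

locale loss_network = prob_space M
  for M :: "'a measure" +
  fixes rate :: real
    and \<tau> B \<theta> :: "int \<Rightarrow> 'a \<Rightarrow> real"
  assumes rate_pos: "rate > 0"
    and interarrival_nonneg: "\<And>n. AE \<omega> in M. \<tau> n \<omega> - \<tau> (n - 1) \<omega> \<ge> 0"
    and interarrival_iid: "iid (\<lambda>n \<omega>. \<tau> n \<omega> - \<tau> (n - 1) \<omega>)"
    and interarrival_integrable: "\<And>n. integrable M (\<lambda>\<omega>. \<tau> n \<omega> - \<tau> (n - 1) \<omega>)"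
    and interarrival_mean: "\<And>n. expectation (\<lambda>\<omega>. \<tau> n \<omega> - \<tau> (n - 1) \<omega>) = 1 / rate"
    and requirement_iid: "iid B"
    and holding_nonneg: "\<And>n. AE \<omega> in M. \<theta> n \<omega> \<ge> 0"
    and holding_iid: "iid \<theta>"
    and holding_integrable: "\<And>n. integrable M (\<theta> n)"
    and sequences_indep:
      "indep_vars (\<lambda>_. \<Pi>\<^sub>M n\<in>UNIV. borel) (\<lambda>k \<omega> n. ([\<tau>, B, \<theta>] ! k) n \<omega>) {..<3}"
begin

text \<open>
  The argument \<open>Q\<close> is the path-valued process of engaged resources; request \<open>i\<close> is accepted iff
  \<open>Q i \<omega> + B i \<omega> \<le> C\<close>.
\<close>

definition active :: "real \<Rightarrow> (int \<Rightarrow> 'a \<Rightarrow> real) \<Rightarrow> int \<Rightarrow> 'a \<Rightarrow> int set" where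
  "active C Q n \<omega> = {i. i < n \<and> Q i \<omega> + B i \<omega> \<le> C \<and> \<theta> i \<omega> > \<tau> n \<omega> - \<tau> i \<omega>}"

text \<open>
  The stationary regime: a stationary two-sided process driven by the given arrivals. The sum is
  over an almost surely finite set, because the holding times have finite mean.
\<close>

definition stationary_regime :: "real \<Rightarrow> (int \<Rightarrow> 'a \<Rightarrow> real) \<Rightarrow> bool" where
  "stationary_regime C Q \<longleftrightarrow> stationary Q \<and>
     (AE \<omega> in M. \<forall>n. Q n \<omega> = (\<Sum>i\<in>active C Q n \<omega>. B i \<omega>))"

end

end

theory Submission
  imports Defs
begin

text \<open>
  Engaged resources are nonnegative, so an arrival that requires more than \<open>C\<close> is always blocked; this
  gives the lower bound. For the upper bound, an accepted request requires at most \<open>C\<close>, and whether a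
  request would still be active at the arrival of \<open>n\<close> if it were accepted depends on arrival and holding times
  only. Let \<open>N\<close> be the random set of earlier requests with that property. Blocking of \<open>n\<close> implies
  \<open>B n + (\<Sum>i\<in>N. if B i \<le> C then B i else 0) > C\<close>, where \<open>N\<close> is independent of the requirements.
  The dependence that acceptance decisions create between requests has disappeared.

  For a fixed finite set \<open>N\<close>, a sum of independent subexponential variables exceeds a high level essentially
  only because one of its terms does. The truncated terms cannot, so that term must be \<open>B n\<close>,
  and the probability is asymptotic to the tail of a single requirement
  (\<open>excess_ratio_tendsto\<close>, \<open>prob_truncated_sum_bounds\<close>).

  It remains to average over \<open>N\<close> by dominated convergence. Kesten's bound (\<open>kesten_bound\<close>) dominates the ratio
  by a multiple of \<open>(1 + \<epsilon>) ^ card N\<close>, for any prescribed \<open>\<epsilon> > 0\<close>. The expectation of this power is finite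
  for some \<open>\<epsilon>\<close> (\<open>present_exponential_moment\<close>), because the expected number of requests present is bounded
  and the requests present before the last one that is present were already present when it arrived
  (\<open>overlap_prob_summable\<close>, \<open>load_weight_bounded\<close>).
\<close>

section \<open>Sums of independent copies\<close>

primrec convolution_power :: "real measure \<Rightarrow> nat \<Rightarrow> real measure" where
  "convolution_power D 0 = return borel 0"
| "convolution_power D (Suc n) = (D \<star> convolution_power D n)"

text \<open>
  The tail of the \<open>n\<close>-fold sum is studied through convolution powers rather than through a product
  space, because the recursion \<open>conv_tail_Suc\<close> then carries every induction on \<open>n\<close>.
\<close>

definition conv_tail :: "real measure \<Rightarrow> nat \<Rightarrow> real \<Rightarrow> real" where
  "conv_tail D n x = measure (convolution_power D n) {x<..}"

lemma (in prob_space) distr_iid_sum: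
  fixes X :: "'i \<Rightarrow> 'a \<Rightarrow> real"
  assumes "finite I" "indep_vars (\<lambda>_. borel) X I" "\<And>i. i \<in> I \<Longrightarrow> distr M borel (X i) = D"
  shows "distr M borel (\<lambda>\<omega>. \<Sum>i\<in>I. X i \<omega>) = convolution_power D (card I)"
  using assms
proof (induction I rule: finite_induct)
  case empty
  show ?case by (simp add: distr_const)
next
  case (insert j J)
  have rv: "random_variable borel (X i)" if "i \<in> insert j J" for i
    using insert.prems(1) that by (auto simp: indep_vars_def)
  then have [measurable]: "random_variable borel (X j)" "random_variable borel (\<lambda>\<omega>. \<Sum>i\<in>J. X i \<omega>)"
    by auto
  have "indep_vars (\<lambda>_. borel) X J"
    using insert.prems(1) by (rule indep_vars_subset) auto
  then have "distr M borel (\<lambda>\<omega>. \<Sum>i\<in>J. X i \<omega>) = convolution_power D (card J)"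
    using insert by simp
  then show ?case
    using insert sum_indep_random_variable[OF indep_vars_sum[OF insert.hyps insert.prems(1)]]
    by simp
qed

lemma (in prob_space) prob_iid_sum_greater:
  fixes X :: "'i \<Rightarrow> 'a \<Rightarrow> real"
  assumes "finite I" "indep_vars (\<lambda>_. borel) X I" "\<And>i. i \<in> I \<Longrightarrow> distr M borel (X i) = D"
  shows "\<P>(\<omega> in M. (\<Sum>i\<in>I. X i \<omega>) > x) = conv_tail D (card I) x"
proof -
  have [measurable]: "random_variable borel (\<lambda>\<omega>. \<Sum>i\<in>I. X i \<omega>)"
    using assms(2) by (intro borel_measurable_sum) (auto simp: indep_vars_def)
  have "conv_tail D (card I) x = measure (distr M borel (\<lambda>\<omega>. \<Sum>i\<in>I. X i \<omega>)) {x<..}"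
    by (subst distr_iid_sum[OF assms]) (simp_all add: conv_tail_def)
  also have "\<dots> = \<P>(\<omega> in M. (\<Sum>i\<in>I. X i \<omega>) > x)"
    by (subst measure_distr) (auto intro!: arg_cong[where f = prob])
  finally show ?thesis ..
qed

section \<open>Subexponential tails\<close>

text \<open>
  The definition of subexponentiality fixes some unspecified number of summands. Reducing it to two
  summands uses only the facts available here, for any positive law with unbounded support.
\<close>

locale positive_law = real_distribution D for D :: "real measure" +
  assumes pos: "AE x in D. x > 0"
    and cdf_less_1: "\<And>x. x > 0 \<Longrightarrow> cdf D x < 1"
begin

lemma sets_convolution_power [simp]: "sets (convolution_power D n) = sets borel"
  by (cases n) simp_all

lemma prob_space_convolution_power: "prob_space (convolution_power D n)"
proof (induction n)
  case 0
  show ?case by (simp add: prob_space_return)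
next
  case (Suc n)
  interpret N: prob_space "convolution_power D n" by (rule Suc)
  interpret P: pair_prob_space D "convolution_power D n" ..
  show ?case
    unfolding convolution_power.simps convolution_def 
    by (rule P.prob_space_distr) (simp cong: measurable_cong_sets)
qed

lemma conv_tail_nonneg: "0 \<le> conv_tail D n x"
  by (simp add: conv_tail_def)

lemma conv_tail_le_1: "conv_tail D n x \<le> 1"
  unfolding conv_tail_def
  by (rule prob_space.prob_le_1[OF prob_space_convolution_power])

lemma conv_tail_antimono: "x \<le> y \<Longrightarrow> conv_tail D n y \<le> conv_tail D n x"
proof -
  interpret N: prob_space "convolution_power D n" by (rule prob_space_convolution_power)
  show "x \<le> y \<Longrightarrow> conv_tail D n y \<le> conv_tail D n x"
    unfolding conv_tail_def by (rule N.finite_measure_mono) auto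
qed

lemma measurable_conv_tail [measurable]: "conv_tail D n \<in> borel_measurable borel"
proof -
  have "mono (\<lambda>x. - conv_tail D n x)"
    by (auto intro!: monoI conv_tail_antimono)
  then have "(\<lambda>x. - (- conv_tail D n x)) \<in> borel_measurable borel"
    by (intro borel_measurable_uminus borel_measurable_mono)
  then show ?thesis by simp
qed

lemma integrable_bounded:
  assumes [measurable]: "f \<in> borel_measurable borel" and "\<And>x. \<bar>f x\<bar> \<le> (c::real)"
  shows "integrable D f"
  by (rule integrable_const_bound[where B = c]) (use assms in auto)

lemma integrable_conv_tail: "integrable D (\<lambda>y. conv_tail D n (x - y))"
  by (rule integrable_bounded[where c = 1]) (auto simp: conv_tail_nonneg conv_tail_le_1)

lemma conv_tail_0: "conv_tail D 0 x = of_bool (x < 0)"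
  by (simp add: conv_tail_def measure_return indicator_def)

lemma conv_tail_Suc: "conv_tail D (Suc n) x = (\<integral>y. conv_tail D n (x - y) \<partial>D)"
proof -
  interpret N: prob_space "convolution_power D n" by (rule prob_space_convolution_power)
  interpret N': prob_space "convolution_power D (Suc n)" by (rule prob_space_convolution_power)
  have "emeasure (convolution_power D (Suc n)) {x<..}
      = (\<integral>\<^sup>+y. emeasure (convolution_power D n) {a. a + y \<in> {x<..}} \<partial>D)"
    unfolding convolution_power.simps
    by (intro convolution_emeasure) (auto simp: N.finite_measure_axioms finite_measure_axioms
        sets_eq_imp_space_eq[OF sets_convolution_power])
  also have "\<dots> = (\<integral>\<^sup>+y. ennreal (conv_tail D n (x - y)) \<partial>D)"
    by (intro nn_integral_cong)
       (auto simp: N.emeasure_eq_measure conv_tail_def greaterThan_def algebra_simps)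
  also have "\<dots> = ennreal (\<integral>y. conv_tail D n (x - y) \<partial>D)"
    by (intro nn_integral_eq_integral integrable_conv_tail) (simp add: conv_tail_nonneg)
  finally show ?thesis
    unfolding N'.emeasure_eq_measure
    by (subst (asm) ennreal_inj) (auto simp: conv_tail_def intro!: integral_nonneg_AE)
qed

lemma conv_tail_neg: "x < 0 \<Longrightarrow> conv_tail D n x = 1"
proof (induction n arbitrary: x)
  case 0
  then show ?case by (simp add: conv_tail_0)
next
  case (Suc n)
  have "(\<integral>y. conv_tail D n (x - y) \<partial>D) = (\<integral>y. 1 \<partial>D)"
    by (intro integral_cong_AE) (use pos Suc in auto)
  then show ?case using prob_space by (simp add: conv_tail_Suc)
qed

text \<open>
  The tail \<open>1 - F\<close> enters as the one-fold convolution tail, so that the recursion applies to it;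
  the index is written \<open>Suc 0\<close>, the normal form of the simplifier.
\<close>

abbreviation (input) F where "F \<equiv> cdf D"
abbreviation (input) Fc where "Fc \<equiv> conv_tail D (Suc 0)"

lemma Fc_eq: "Fc x = 1 - F x"
proof -
  have "Fc x = (\<integral>y. indicator {x<..} y \<partial>D)"
    unfolding conv_tail_Suc
    by (intro Bochner_Integration.integral_cong) (auto simp: conv_tail_0 indicator_def)
  also have "\<dots> = prob (space D - {..x})"
    by (auto intro!: arg_cong[where f = prob])
  finally show ?thesis by (subst (asm) prob_compl) (auto simp: cdf_def)
qed

lemma Fc_pos: "0 < Fc x"
proof -
  have "F x \<le> F (max x 1)" by (rule cdf_nondecreasing) simp
  also have "\<dots> < 1" by (rule cdf_less_1) simp
  finally show ?thesis by (simp add: Fc_eq)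
qed

lemma F_nonneg: "0 \<le> F x" by (simp add: cdf_def)

lemma Fc_tendsto_0: "(Fc \<longlongrightarrow> 0) at_top"
  using tendsto_diff[OF tendsto_const cdf_lim_at_top_prob, of 1] by (simp add: Fc_eq[abs_def])

text \<open>
  Conditioning on the first summand: if it exceeds \<open>x\<close> the sum does too, which accounts for
  the subtracted \<open>Fc x\<close>. What remains is the convolution integral over \<open>y \<le> x\<close>, which subexponentiality
  controls and against which all later integrals are compared.
\<close>

lemma conv_tail_2_split: "conv_tail D 2 x - Fc x = (\<integral>y. indicator {..x} y * Fc (x - y) \<partial>D)"
proof -
  have "conv_tail D 2 x - Fc x
      = (\<integral>y. Fc (x - y) \<partial>D) - (\<integral>y. indicator {x<..} y \<partial>D)"
    unfolding numeral_2_eq_2 conv_tail_Suc[of "Suc 0"]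
    by (auto simp: conv_tail_Suc conv_tail_0 indicator_def intro!: Bochner_Integration.integral_cong)
  also have "\<dots> = (\<integral>y. Fc (x - y) - indicator {x<..} y \<partial>D)"
    by (intro Bochner_Integration.integral_diff[symmetric] integrable_conv_tail integrable_bounded[where c=1])
       (auto simp: indicator_def)
  also have "\<dots> = (\<integral>y. indicator {..x} y * Fc (x - y) \<partial>D)"
    by (intro Bochner_Integration.integral_cong) (auto simp: indicator_def conv_tail_neg)
  finally show ?thesis .
qed

lemma integrable_indicator_Fc: "integrable D (\<lambda>y. indicator {..x} y * Fc (x - y))"
  by (rule integrable_bounded[where c = 1]) (auto simp: indicator_def conv_tail_nonneg conv_tail_le_1)

text \<open>
  A bound on the \<open>n\<close>-fold tail beyond \<open>t\<close> passes to the next tail: where the first summand \<open>y\<close> is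
  at most \<open>x - t\<close> the bound applies at \<open>x - y \<ge> t\<close>, and otherwise the tail is at most 1. With \<open>t = 0\<close>
  this step gives Kesten's bound, with large \<open>t\<close> the exact asymptotics.
\<close>

lemma conv_tail_Suc_le:
  assumes "t \<ge> 0" "a \<ge> 0" and le: "\<And>u. u \<ge> t \<Longrightarrow> conv_tail D n u \<le> a * Fc u"
  shows "conv_tail D (Suc n) x \<le> Fc (x - t) + a * (conv_tail D 2 x - Fc x)"
proof -
  have "conv_tail D (Suc n) x \<le> (\<integral>y. indicator {x-t<..} y + a * (indicator {..x} y * Fc (x - y)) \<partial>D)"
    unfolding conv_tail_Suc[of n]
  proof (intro integral_mono integrable_conv_tail Bochner_Integration.integrable_add
      integrable_mult_right integrable_indicator_Fc integrable_bounded[where c = 1])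
    fix y
    show "conv_tail D n (x - y) \<le> indicator {x-t<..} y + a * (indicator {..x} y * Fc (x - y))"
    proof (cases "y > x - t")
      case True
      then show ?thesis
        using conv_tail_le_1[of n "x - y"] conv_tail_nonneg[of "Suc 0" "x - y"] \<open>a \<ge> 0\<close>
        by (auto intro!: add_increasing2)
    next
      case False
      then show ?thesis using le[of "x - y"] \<open>t \<ge> 0\<close> by auto
    qed
  qed (auto simp: indicator_def)
  also have "\<dots> = (\<integral>y. indicator {x-t<..} y \<partial>D) + a * (\<integral>y. indicator {..x} y * Fc (x - y) \<partial>D)"
    by (subst Bochner_Integration.integral_add)
       (auto intro!: integrable_bounded[where c=1] integrable_mult_right integrable_indicator_Fc 
        simp: indicator_def conv_tail_nonneg conv_tail_le_1)
  also have "(\<integral>y. indicator {x-t<..} y \<partial>D) = Fc (x - t)"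
    unfolding conv_tail_Suc
    by (intro Bochner_Integration.integral_cong) (auto simp: conv_tail_0 indicator_def)
  finally show ?thesis by (simp add: conv_tail_2_split)
qed

lemma conv_tail_Suc_ge:
  assumes "x \<ge> 0"
  shows "Fc x + F x * conv_tail D n x \<le> conv_tail D (Suc n) x"
proof -
  have Fc: "Fc x = (\<integral>y. indicator {x<..} y \<partial>D)"
    unfolding conv_tail_Suc[of 0]
    by (intro Bochner_Integration.integral_cong) (auto simp: conv_tail_0 indicator_def)
  have "Fc x + F x * conv_tail D n x
      = (\<integral>y. indicator {x<..} y \<partial>D) + (\<integral>y. indicator {..x} y * conv_tail D n x \<partial>D)"
    unfolding Fc by (simp add: cdf_def)
  also have "\<dots> = (\<integral>y. indicator {x<..} y + indicator {..x} y * conv_tail D n x \<partial>D)"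
    by (intro Bochner_Integration.integral_add[symmetric] integrable_bounded[where c=1])
       (auto simp: indicator_def conv_tail_nonneg conv_tail_le_1)
  also have "\<dots> \<le> (\<integral>y. conv_tail D n (x - y) \<partial>D)"
  proof (rule integral_mono_AE)
    show "integrable D (\<lambda>y. indicator {x<..} y + indicator {..x} y * conv_tail D n x)"
      by (rule integrable_bounded[where c=1]) (auto simp: indicator_def conv_tail_nonneg conv_tail_le_1)
    show "AE y in D. indicator {x<..} y + indicator {..x} y * conv_tail D n x \<le> conv_tail D n (x - y)"
      using pos by eventually_elim
        (use assms in \<open>auto simp: indicator_def conv_tail_neg intro!: conv_tail_antimono\<close>)
  qed (rule integrable_conv_tail)
  finally show ?thesis by (simp only: conv_tail_Suc[of n])
qed

text \<open>
  For \<open>n\<close> independent positive variables, \<open>1 - F x ^ n\<close> is the probability that the largest one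
  exceeds \<open>x\<close>, and then so does the sum. Hence \<open>excess n x\<close> is the probability that the sum exceeds \<open>x\<close>
  although no summand does. Subexponentiality says that it is negligible against the tail.
\<close>

definition excess :: "nat \<Rightarrow> real \<Rightarrow> real" where
  "excess n x = conv_tail D n x - (1 - F x ^ n)"

text \<open>
  Adjoin a summand that is at most \<open>x\<close>, an event of probability \<open>F x\<close>: the sum of the others still
  exceeds \<open>x\<close> and there is still no summand above \<open>x\<close>.
\<close>

lemma excess_Suc_ge: "x \<ge> 0 \<Longrightarrow> F x * excess n x \<le> excess (Suc n) x"
  using conv_tail_Suc_ge[of x n] by (simp add: excess_def Fc_eq algebra_simps)

lemma excess_nonneg: "x \<ge> 0 \<Longrightarrow> 0 \<le> excess n x"
proof (induction n)
  case 0
  then show ?case by (simp add: excess_def conv_tail_0)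
next
  case (Suc n)
  then have "0 \<le> F x * excess n x" by (simp add: F_nonneg)
  with excess_Suc_ge[OF Suc.prems, of n] show ?case by linarith
qed

lemma excess_add_ge: "x \<ge> 0 \<Longrightarrow> F x ^ k * excess n x \<le> excess (n + k) x"
proof (induction k)
  case (Suc k)
  have "F x ^ Suc k * excess n x = F x * (F x ^ k * excess n x)" by simp
  also have "\<dots> \<le> F x * excess (n + k) x"
    using Suc by (intro mult_left_mono) (auto simp: F_nonneg)
  also have "\<dots> \<le> excess (n + Suc k) x" using excess_Suc_ge[OF Suc.prems] by simp
  finally show ?case .
qed simp

lemma max_tail_ratio: "(1 - F x ^ n) / Fc x = (\<Sum>k<n. F x ^ k)"
proof -
  have "1 - F x ^ n = Fc x * (\<Sum>k<n. F x ^ k)"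
    unfolding Fc_eq by (rule one_diff_power_eq)
  then show ?thesis using Fc_pos[of x] by simp
qed

lemma max_tail_ratio_tendsto: "((\<lambda>x. (1 - F x ^ n) / Fc x) \<longlongrightarrow> real n) at_top"
proof -
  have "((\<lambda>x. \<Sum>k<n. F x ^ k) \<longlongrightarrow> (\<Sum>k<n. 1 ^ k)) at_top"
    by (intro tendsto_intros cdf_lim_at_top_prob)
  then show ?thesis by (simp add: max_tail_ratio)
qed

lemma conv_tail_ratio: "conv_tail D n x / Fc x = excess n x / Fc x + (1 - F x ^ n) / Fc x"
  by (simp add: excess_def diff_divide_distrib)

lemma ratio_tendsto_iff_excess:
  "((\<lambda>x. conv_tail D n x / Fc x) \<longlongrightarrow> real n) at_top \<longleftrightarrow> ((\<lambda>x. excess n x / Fc x) \<longlongrightarrow> 0) at_top"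
proof
  assume "((\<lambda>x. conv_tail D n x / Fc x) \<longlongrightarrow> real n) at_top"
  from tendsto_diff[OF this max_tail_ratio_tendsto[of n]]
  show "((\<lambda>x. excess n x / Fc x) \<longlongrightarrow> 0) at_top" by (simp add: conv_tail_ratio)
next
  assume "((\<lambda>x. excess n x / Fc x) \<longlongrightarrow> 0) at_top"
  from tendsto_add[OF this max_tail_ratio_tendsto[of n]]
  show "((\<lambda>x. conv_tail D n x / Fc x) \<longlongrightarrow> real n) at_top" by (simp add: conv_tail_ratio)
qed

text \<open>
  The defining limit for one \<open>n \<ge> 2\<close> implies the one for \<open>n = 2\<close>, because
  \<open>excess 2 \<le> excess n / F ^ (n - 2)\<close> and \<open>F\<close> tends to 1.
\<close>

lemma two_fold_ratio_from_n_fold: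
  assumes "n \<ge> 2" and lim: "((\<lambda>x. conv_tail D n x / Fc x) \<longlongrightarrow> real n) at_top"
  shows "((\<lambda>x. conv_tail D 2 x / Fc x) \<longlongrightarrow> 2) at_top"
proof -
  have "((\<lambda>x. (excess n x / Fc x) / F x ^ (n - 2)) \<longlongrightarrow> 0 / 1 ^ (n - 2)) at_top"
    using lim unfolding ratio_tendsto_iff_excess
    by (intro tendsto_intros cdf_lim_at_top_prob) auto
  then have upper: "((\<lambda>x. (excess n x / Fc x) / F x ^ (n - 2)) \<longlongrightarrow> 0) at_top" by simp
  have "eventually (\<lambda>x. F x > 0) at_top"
    using order_tendstoD(1)[OF cdf_lim_at_top_prob, of 0] by simp
  then have "eventually (\<lambda>x. excess 2 x / Fc x \<le> (excess n x / Fc x) / F x ^ (n - 2)) at_top"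
    using eventually_ge_at_top[of 0]
  proof eventually_elim
    case (elim x)
    then have "F x ^ (n - 2) * excess 2 x \<le> excess n x"
      using excess_add_ge[of x "n - 2" 2] \<open>n \<ge> 2\<close> by (simp del: add_2_eq_Suc)
    then show ?case using elim Fc_pos[of x] by (simp add: field_simps)
  qed
  moreover have "eventually (\<lambda>x. 0 \<le> excess 2 x / Fc x) at_top"
    using eventually_ge_at_top[of 0]
    by eventually_elim (auto intro!: divide_nonneg_pos excess_nonneg Fc_pos)
  ultimately have "((\<lambda>x. excess 2 x / Fc x) \<longlongrightarrow> 0) at_top"
    by (rule tendsto_sandwich[OF _ _ tendsto_const upper, rotated])
  then show ?thesis using ratio_tendsto_iff_excess[of 2] by simp
qed

end

locale subexponential_law = positive_law +
  assumes two_fold: "((\<lambda>x. conv_tail D 2 x / Fc x) \<longlongrightarrow> 2) at_top"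
begin

text \<open>
  In the integral of \<open>conv_tail_2_split\<close> the integrand is at least \<open>Fc x\<close> for \<open>y \<le> t\<close> and at least
  \<open>Fc (x - t)\<close> for \<open>t < y \<le> x\<close>. The whole integral is asymptotic to \<open>Fc x\<close>, so the second part leaves
  \<open>Fc (x - t)\<close> no room to be larger.
\<close>

lemma long_tailed:
  assumes "t > 0"
  shows "((\<lambda>x. Fc (x - t) / Fc x) \<longlongrightarrow> 1) at_top"
proof -
  have Ft: "F t < 1" using assms by (rule cdf_less_1)
  have "((\<lambda>x. (conv_tail D 2 x / Fc x - 1 - F t) / (F x - F t)) \<longlongrightarrow> (2 - 1 - F t) / (1 - F t)) at_top"
    using Ft by (intro tendsto_intros two_fold cdf_lim_at_top_prob) auto
  then have upper: "((\<lambda>x. (conv_tail D 2 x / Fc x - 1 - F t) / (F x - F t)) \<longlongrightarrow> 1) at_top"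
    using Ft by simp
  have "eventually (\<lambda>x. F x > F t) at_top"
    using order_tendstoD(1)[OF cdf_lim_at_top_prob Ft] .
  then have "eventually (\<lambda>x. Fc (x - t) / Fc x \<le> (conv_tail D 2 x / Fc x - 1 - F t) / (F x - F t)) at_top"
    using eventually_ge_at_top[of t]
  proof eventually_elim
    case (elim x)
    have prob: "prob {t<..x} = F x - F t"
      using elim by (cases "t = x") (auto simp: cdf_diff_eq)
    have "F t * Fc x + (F x - F t) * Fc (x - t)
        = (\<integral>y. indicator {..t} y * Fc x \<partial>D) + (\<integral>y. indicator {t<..x} y * Fc (x - t) \<partial>D)"
      using prob by (simp add: cdf_def)
    also have "\<dots> = (\<integral>y. indicator {..t} y * Fc x + indicator {t<..x} y * Fc (x - t) \<partial>D)"
      by (intro Bochner_Integration.integral_add[symmetric] integrable_bounded[where c=1])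
         (auto simp: indicator_def conv_tail_nonneg conv_tail_le_1)
    also have "\<dots> \<le> (\<integral>y. indicator {..x} y * Fc (x - y) \<partial>D)"
    proof (rule integral_mono_AE)
      show "integrable D (\<lambda>y. indicator {..t} y * Fc x + indicator {t<..x} y * Fc (x - t))"
        by (rule integrable_bounded[where c=1]) (auto simp: indicator_def conv_tail_nonneg conv_tail_le_1)
      show "AE y in D. indicator {..t} y * Fc x + indicator {t<..x} y * Fc (x - t) \<le> indicator {..x} y * Fc (x - y)"
        using pos by eventually_elim
          (use elim in \<open>auto simp: indicator_def intro!: conv_tail_antimono\<close>)
    qed (rule integrable_indicator_Fc)
    finally have "F t * Fc x + (F x - F t) * Fc (x - t) \<le> conv_tail D 2 x - Fc x"
      by (simp add: conv_tail_2_split)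
    then have "Fc (x - t) * (F x - F t) / Fc x \<le> (conv_tail D 2 x - Fc x - F t * Fc x) / Fc x"
      using Fc_pos[of x] by (intro divide_right_mono) (auto simp: algebra_simps)
    also have "\<dots> = conv_tail D 2 x / Fc x - 1 - F t"
      using Fc_pos[of x] by (simp add: diff_divide_distrib)
    finally show ?case using elim by (simp add: pos_le_divide_eq)
  qed
  moreover have "1 \<le> Fc (x - t) / Fc x" for x
    using assms Fc_pos[of x] conv_tail_antimono[of "x - t" x "Suc 0"] by simp
  ultimately show ?thesis
    using tendsto_sandwich[OF _ _ tendsto_const upper] by auto
qed

text \<open>
  The lower bound is the probability that some summand exceeds \<open>x\<close>. For the upper bound, the \<open>n\<close>-fold
  tail is at most \<open>(n + e) * Fc\<close> beyond some \<open>t\<close>, and \<open>conv_tail_Suc_le\<close> adds one more summand at the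
  cost of \<open>Fc (x - t)\<close>, which is asymptotic to \<open>Fc x\<close>.
\<close>

lemma conv_tail_ratio_tendsto: "((\<lambda>x. conv_tail D n x / Fc x) \<longlongrightarrow> real n) at_top"
proof (induction n)
  case 0
  have "eventually (\<lambda>x. conv_tail D 0 x / Fc x = 0) at_top"
    using eventually_ge_at_top[of 0] by eventually_elim (simp add: conv_tail_0)
  then show ?case by (simp add: tendsto_eventually)
next
  case (Suc n)
  show ?case
  proof (rule order_tendstoI)
    fix c assume "c < real (Suc n)"
    with max_tail_ratio_tendsto[of "Suc n"]
    have "eventually (\<lambda>x. c < (1 - F x ^ Suc n) / Fc x) at_top" by (rule order_tendstoD)
    then show "eventually (\<lambda>x. c < conv_tail D (Suc n) x / Fc x) at_top"
      using eventually_ge_at_top[of 0]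
    proof eventually_elim
      case (elim x)
      have "0 \<le> excess (Suc n) x / Fc x" using elim Fc_pos[of x] by (simp add: excess_nonneg)
      then show ?case using elim by (simp add: conv_tail_ratio)
    qed
  next
    fix c assume c: "real (Suc n) < c"
    define e where "e = (c - real (Suc n)) / 2"
    have e: "e > 0" "1 + (n + e) < c" using c by (auto simp: e_def field_simps)
    have "eventually (\<lambda>u. conv_tail D n u / Fc u < n + e) at_top"
      using Suc e by (intro order_tendstoD(2)) auto
    then obtain t0 where t0: "\<And>u. u \<ge> t0 \<Longrightarrow> conv_tail D n u / Fc u < n + e"
      by (auto simp: eventually_at_top_linorder)
    define t where "t = max t0 1"
    have bound: "conv_tail D n u \<le> (n + e) * Fc u" if "u \<ge> t" for u
      using t0[of u] that Fc_pos[of u] by (simp add: t_def field_simps)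
    have "((\<lambda>x. Fc (x - t) / Fc x + (n + e) * (conv_tail D 2 x / Fc x - 1)) \<longlongrightarrow> 1 + (n + e) * (2 - 1)) at_top"
      by (intro tendsto_intros long_tailed two_fold) (simp add: t_def)
    then have "eventually (\<lambda>x. Fc (x - t) / Fc x + (n + e) * (conv_tail D 2 x / Fc x - 1) < c) at_top"
      using e by (intro order_tendstoD(2)) auto
    then show "eventually (\<lambda>x. conv_tail D (Suc n) x / Fc x < c) at_top"
    proof eventually_elim
      case (elim x)
      have "conv_tail D (Suc n) x \<le> Fc (x - t) + (n + e) * (conv_tail D 2 x - Fc x)"
        using e by (intro conv_tail_Suc_le bound) (auto simp: t_def)
      then have "conv_tail D (Suc n) x / Fc x \<le> (Fc (x - t) + (n + e) * (conv_tail D 2 x - Fc x)) / Fc x"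
        using Fc_pos[of x] by (intro divide_right_mono) auto
      also have "\<dots> = Fc (x - t) / Fc x + (n + e) * (conv_tail D 2 x / Fc x - 1)"
        using Fc_pos[of x] by (simp add: field_simps)
      finally show ?case using elim by simp
    qed
  qed
qed

lemma excess_ratio_tendsto: "((\<lambda>x. excess n x / Fc x) \<longlongrightarrow> 0) at_top"
  using conv_tail_ratio_tendsto ratio_tendsto_iff_excess by blast

text \<open>
  Kesten's bound. Beyond some \<open>t\<close> the convolution integral is at most \<open>(1 + \<epsilon> / 2) * Fc x\<close>, so one more
  summand multiplies the constant by \<open>1 + \<epsilon> / 2\<close> and adds 1. Below \<open>t\<close> the tail is bounded away from
  zero and any large constant does.
\<close>

lemma kesten_bound:
  assumes "\<epsilon> > 0"
  obtains K where "\<And>n x. conv_tail D n x \<le> K * (1 + \<epsilon>) ^ n * Fc x"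
proof -
  have "eventually (\<lambda>x. conv_tail D 2 x / Fc x < 2 + \<epsilon> / 2) at_top"
    using two_fold assms by (intro order_tendstoD(2)) auto
  then obtain t where t: "\<And>x. x \<ge> t \<Longrightarrow> conv_tail D 2 x / Fc x < 2 + \<epsilon> / 2"
    by (auto simp: eventually_at_top_linorder)
  \<comment> \<open>The value \<open>2 / \<epsilon>\<close> lets the spare factor \<open>\<epsilon> / 2\<close> absorb the added 1; \<open>1 / Fc t\<close> covers \<open>x < t\<close>.\<close>
  define K where "K = Max {1, 2 / \<epsilon>, 1 / Fc t}"
  have K: "K \<ge> 1" "K \<ge> 2 / \<epsilon>" "K \<ge> 1 / Fc t"
    by (auto simp: K_def)
  have K1: "1 \<le> K * (1 + \<epsilon>) ^ n" for n
    using K(1) assms mult_mono[of 1 K 1 "(1 + \<epsilon>) ^ n"] by simp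
  have "conv_tail D n x \<le> K * (1 + \<epsilon>) ^ n * Fc x" for n x
  proof (induction n arbitrary: x)
    case 0
    have "1 \<le> K * Fc x" if "x < 0" using that K(1) by (simp add: conv_tail_neg)
    then show ?case using Fc_pos[of x] K(1) by (auto simp: conv_tail_0)
  next
    case (Suc n)
    let ?a = "K * (1 + \<epsilon>) ^ n"
    have a: "?a \<ge> 1" by (rule K1)
    show ?case
    proof (cases "x \<ge> t")
      case True
      have "conv_tail D 2 x - Fc x \<le> (1 + \<epsilon> / 2) * Fc x"
        using t[OF True] Fc_pos[of x] by (simp add: field_simps)
      then have "?a * (conv_tail D 2 x - Fc x) \<le> ?a * ((1 + \<epsilon> / 2) * Fc x)"
        using a by (intro mult_left_mono) auto
      moreover have "conv_tail D (Suc n) x \<le> Fc (x - 0) + ?a * (conv_tail D 2 x - Fc x)"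
        using a by (intro conv_tail_Suc_le Suc) auto
      ultimately have "conv_tail D (Suc n) x \<le> (1 + ?a * (1 + \<epsilon> / 2)) * Fc x"
        by (simp add: algebra_simps)
      also have "\<dots> \<le> (K * (1 + \<epsilon>) ^ Suc n) * Fc x"
      proof (intro mult_right_mono)
        have "1 \<le> K * \<epsilon> / 2" using K(2) assms by (simp add: field_simps)
        also have "\<dots> \<le> (K * \<epsilon> / 2) * (1 + \<epsilon>) ^ n"
          using K(1) assms mult_left_mono[of 1 "(1 + \<epsilon>) ^ n" "K * \<epsilon> / 2"] by simp
        finally show "1 + ?a * (1 + \<epsilon> / 2) \<le> K * (1 + \<epsilon>) ^ Suc n" by (simp add: algebra_simps)
      qed (simp add: conv_tail_nonneg)
      finally show ?thesis .
    next
      case False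
      have "conv_tail D (Suc n) x \<le> 1" by (rule conv_tail_le_1)
      also have "1 \<le> K * Fc t" using K(3) Fc_pos[of t] by (simp add: field_simps)
      also have "\<dots> \<le> (K * (1 + \<epsilon>) ^ Suc n) * Fc x"
      proof (intro mult_mono)
        show "K \<le> K * (1 + \<epsilon>) ^ Suc n"
          using K(1) assms by (simp add: mult_le_cancel_left1 del: power_Suc)
        show "Fc t \<le> Fc x" using False by (intro conv_tail_antimono) auto
      qed (use K1[of "Suc n"] in \<open>auto simp: conv_tail_nonneg\<close>)
      finally show ?thesis .
    qed
  qed
  then show ?thesis by (rule that)
qed

end

text \<open>
  The coordinates of a product space are independent copies of \<open>D\<close>, so the tail in the definition of
  subexponentiality is a convolution tail.
\<close>

lemma subexponential_lawI:
  assumes "subexponential D"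
  shows "subexponential_law D"
proof -
  interpret real_distribution D using assms by (simp add: subexponential_def)
  interpret positive_law D
    by unfold_locales (use assms in \<open>auto simp: subexponential_def\<close>)
  obtain n :: nat where "n \<ge> 2" and lim: "((\<lambda>x. \<P>(X in (\<Pi>\<^sub>M i\<in>{..<n}. D). (\<Sum>i<n. X i) > x) / (1 - cdf D x))
                \<longlongrightarrow> real n) at_top"
    using assms by (auto simp: subexponential_def)
  interpret P: prob_space "\<Pi>\<^sub>M i\<in>{..<n}. D"
    by (rule prob_space_PiM) (rule prob_space_axioms)
  have distr: "distr (\<Pi>\<^sub>M i\<in>{..<n}. D) borel (\<lambda>X. X i) = D" if "i < n" for i
    using that distr_PiM_component[of "{..<n}" "\<lambda>_. D" i] prob_space_axioms
    by (simp cong: distr_cong)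
  have "P.indep_vars (\<lambda>_. borel) (\<lambda>i X. X i) {..<n}"
  proof (subst P.indep_vars_iff_distr_eq_PiM')
    show "distr (\<Pi>\<^sub>M i\<in>{..<n}. D) (\<Pi>\<^sub>M i\<in>{..<n}. borel) (\<lambda>X. \<lambda>i\<in>{..<n}. X i)
        = (\<Pi>\<^sub>M i\<in>{..<n}. distr (\<Pi>\<^sub>M i\<in>{..<n}. D) borel (\<lambda>X. X i))"
    proof -
      have "distr (\<Pi>\<^sub>M i\<in>{..<n}. D) (\<Pi>\<^sub>M i\<in>{..<n}. borel) (\<lambda>X. \<lambda>i\<in>{..<n}. X i)
          = distr (\<Pi>\<^sub>M i\<in>{..<n}. D) (\<Pi>\<^sub>M i\<in>{..<n}. D) (\<lambda>X. X)"
        by (intro distr_cong sets_PiM_cong) (auto simp: space_PiM PiE_def extensional_restrict)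
      also have "\<dots> = (\<Pi>\<^sub>M i\<in>{..<n}. D)" by simp
      also have "\<dots> = (\<Pi>\<^sub>M i\<in>{..<n}. distr (\<Pi>\<^sub>M i\<in>{..<n}. D) borel (\<lambda>X. X i))"
        by (intro PiM_cong) (auto simp: distr)
      finally show ?thesis .
    qed
  qed (use \<open>n \<ge> 2\<close> in \<open>auto simp: lessThan_empty_iff\<close>)
  from P.prob_iid_sum_greater[OF _ this distr] lim
  have "((\<lambda>x. conv_tail D n x / Fc x) \<longlongrightarrow> real n) at_top"
    by (simp add: Fc_eq)
  with \<open>n \<ge> 2\<close> show ?thesis
    by unfold_locales (rule two_fold_ratio_from_n_fold)
qed

section \<open>Independence and exponential estimates\<close>

text \<open>
  If the paths are independent and each path has independent coordinates, then all coordinates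
  are jointly independent: a finite intersection of coordinate events first factorises over the paths and
  then within each path.
\<close>

lemma (in prob_space) indep_vars_of_indep_paths:
  fixes X :: "'k \<Rightarrow> 'i \<Rightarrow> 'a \<Rightarrow> 'b"
  assumes paths: "indep_vars (\<lambda>_. \<Pi>\<^sub>M i\<in>UNIV. N) (\<lambda>k \<omega> i. X k i \<omega>) K"
    and coordinates: "\<And>k. k \<in> K \<Longrightarrow> indep_vars (\<lambda>_. N) (X k) UNIV"
  shows "indep_vars (\<lambda>_. N) (\<lambda>(k, i). X k i) (K \<times> UNIV)"
  unfolding indep_vars_def2
proof (intro conjI ballI indep_setsI)
  have rv: "random_variable N (X k i)" if "k \<in> K" for k i
    using coordinates[OF that] by (auto simp: indep_vars_def)
  show "random_variable N (case j of (k, i) \<Rightarrow> X k i)" if "j \<in> K \<times> UNIV" for j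
    using that rv by auto
  show "{(case j of (k, i) \<Rightarrow> X k i) -` A \<inter> space M |A. A \<in> sets N} \<subseteq> events" if "j \<in> K \<times> UNIV" for j
    using that rv by (auto intro: measurable_sets)
  fix A :: "'k \<times> 'i \<Rightarrow> 'a set" and J
  assume J: "J \<noteq> {}" "J \<subseteq> K \<times> (UNIV :: 'i set)" "finite J"
    and "\<forall>j\<in>J. A j \<in> {(case j of (k, i) \<Rightarrow> X k i) -` A \<inter> space M |A. A \<in> sets N}"
  then have "\<forall>j\<in>J. \<exists>E. E \<in> sets N \<and> A j = X (fst j) (snd j) -` E \<inter> space M"
    by (auto simp: split_beta)
  then obtain E where E: "\<And>j. j \<in> J \<Longrightarrow> E j \<in> sets N"
    and A: "\<And>j. j \<in> J \<Longrightarrow> A j = X (fst j) (snd j) -` E j \<inter> space M"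
    by metis
  define L where "L = fst ` J"
  define S where "S k = {i. (k, i) \<in> J}" for k
  define P where "P k = {f \<in> space (\<Pi>\<^sub>M i\<in>(UNIV :: 'i set). N). \<forall>i\<in>S k. f i \<in> E (k, i)}" for k
  have L: "L \<noteq> {}" "L \<subseteq> K" "finite L" using J by (auto simp: L_def)
  have S: "S k \<noteq> {}" if "k \<in> L" for k using that by (auto simp: L_def S_def)
  have finS: "finite (S k)" for k
    by (rule finite_subset[of _ "snd ` J"]) (use J in \<open>auto simp: S_def image_iff Bex_def\<close>)
  have Sig: "J = Sigma L S" by (auto simp: L_def S_def image_iff Bex_def)
  have P: "P k \<in> sets (\<Pi>\<^sub>M i\<in>UNIV. N)" for k
  proof -
    have "E (k, i) \<in> sets N" if "i \<in> S k" for i using that E by (auto simp: S_def)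
    then show ?thesis
      unfolding P_def using finS[of k]
      by (intro sets.sets_Collect_finite_All measurable_sets_Collect[OF measurable_component_singleton]) auto
  qed
  have vimage: "(\<lambda>\<omega> i. X k i \<omega>) -` P k \<inter> space M = (\<Inter>i\<in>S k. A (k, i))" if "k \<in> L" for k
  proof -
    have "X k i \<omega> \<in> space N" if "\<omega> \<in> space M" for i \<omega>
      using rv[of k i] \<open>k \<in> L\<close> L that by (auto dest: measurable_space)
    moreover have "A (k, i) = X k i -` E (k, i) \<inter> space M" if "i \<in> S k" for i
      using A[of "(k, i)"] that by (simp add: S_def)
    ultimately show ?thesis using S[OF that] by (auto simp: P_def space_PiM)
  qed
  have "prob (\<Inter>j\<in>J. A j) = prob (\<Inter>k\<in>L. (\<lambda>\<omega> i. X k i \<omega>) -` P k \<inter> space M)"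
    unfolding Sig by (intro arg_cong[where f = prob]) (auto simp: vimage)
  also have "\<dots> = (\<Prod>k\<in>L. prob ((\<lambda>\<omega> i. X k i \<omega>) -` P k \<inter> space M))"
    by (rule indep_varsD[OF paths L(1,3,2) P])
  also have "\<dots> = (\<Prod>k\<in>L. \<Prod>i\<in>S k. prob (A (k, i)))"
  proof (rule prod.cong[OF refl])
    fix k assume k: "k \<in> L"
    have A': "A (k, i) = X k i -` E (k, i) \<inter> space M" if "i \<in> S k" for i
      using A[of "(k, i)"] that by (simp add: S_def)
    have "prob (\<Inter>i\<in>S k. X k i -` E (k, i) \<inter> space M) = (\<Prod>i\<in>S k. prob (X k i -` E (k, i) \<inter> space M))"
      using k L S[OF k] finS E by (intro indep_varsD[OF coordinates]) (auto simp: S_def)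
    then show "prob ((\<lambda>\<omega> i. X k i \<omega>) -` P k \<inter> space M) = (\<Prod>i\<in>S k. prob (A (k, i)))"
      by (simp add: vimage[OF k] A')
  qed
  also have "\<dots> = (\<Prod>j\<in>J. prob (A j))"
    unfolding Sig by (subst prod.Sigma) (auto simp: L finS)
  finally show "prob (\<Inter>j\<in>J. A j) = (\<Prod>j\<in>J. prob (A j))" .
qed

text \<open>
  Markov's inequality for \<open>exp (- S)\<close>, whose expectation factorises.
\<close>

lemma (in prob_space) prob_sum_less_exponential:
  fixes X :: "'i \<Rightarrow> 'a \<Rightarrow> real"
  assumes I: "finite I" "indep_vars (\<lambda>_. borel) X I"
    and nonneg: "\<And>i. i \<in> I \<Longrightarrow> AE \<omega> in M. X i \<omega> \<ge> 0"
    and q: "\<And>i. i \<in> I \<Longrightarrow> expectation (\<lambda>\<omega>. exp (- X i \<omega>)) = q"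
  shows "\<P>(\<omega> in M. (\<Sum>i\<in>I. X i \<omega>) < x) \<le> exp x * q ^ card I"
proof -
  have rv [measurable]: "random_variable borel (X i)" if "i \<in> I" for i
    using I(2) that by (auto simp: indep_vars_def)
  have int: "integrable M (\<lambda>\<omega>. exp (- X i \<omega>))" if "i \<in> I" for i
    using nonneg[OF that] that by (intro integrable_const_bound[where B = 1]) auto
  have indep: "indep_vars (\<lambda>_. borel) (\<lambda>i \<omega>. exp (- X i \<omega>)) I"
    by (rule indep_vars_compose2[OF I(2)]) measurable
  have "\<P>(\<omega> in M. (\<Sum>i\<in>I. X i \<omega>) < x)
      = (\<integral>\<omega>. indicator {\<omega> \<in> space M. (\<Sum>i\<in>I. X i \<omega>) < x} \<omega> \<partial>M)"
    by (simp add: Int_def conj_commute cong: conj_cong)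
  also have "\<dots> \<le> (\<integral>\<omega>. exp x * (\<Prod>i\<in>I. exp (- X i \<omega>)) \<partial>M)"
  proof (rule integral_mono)
    show "integrable M (\<lambda>\<omega>. exp x * (\<Prod>i\<in>I. exp (- X i \<omega>)))"
      by (intro integrable_mult_right indep_vars_integrable I indep int)
    show "integrable M (indicator {\<omega> \<in> space M. (\<Sum>i\<in>I. X i \<omega>) < x} :: _ \<Rightarrow> real)"
      by (rule integrable_const_bound[where B = 1]) (auto simp: indicator_def)
    show "indicator {\<omega> \<in> space M. (\<Sum>i\<in>I. X i \<omega>) < x} \<omega> \<le> exp x * (\<Prod>i\<in>I. exp (- X i \<omega>))" for \<omega>
      using I(1) by (simp add: indicator_def exp_sum[symmetric] sum_negf prod_nonneg flip: exp_add)
  qed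
  also have "\<dots> = exp x * (\<Prod>i\<in>I. expectation (\<lambda>\<omega>. exp (- X i \<omega>)))"
    by (simp add: indep_vars_lebesgue_integral[OF I(1) indep int])
  finally show ?thesis by (simp add: q)
qed

text \<open>
  A nonnegative variable with \<open>E (exp (- X)) = 1\<close> vanishes almost surely, which a positive mean
  excludes.
\<close>

lemma (in prob_space) expectation_exp_neg_less_1:
  fixes X :: "'a \<Rightarrow> real"
  assumes int: "integrable M X" and nonneg: "AE \<omega> in M. X \<omega> \<ge> 0" and mean: "expectation X > 0"
  shows "0 < expectation (\<lambda>\<omega>. exp (- X \<omega>))" "expectation (\<lambda>\<omega>. exp (- X \<omega>)) < 1"
proof -
  have [measurable]: "random_variable borel X" using int by simp
  have int_exp: "integrable M (\<lambda>\<omega>. exp (- X \<omega>))"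
    using nonneg by (intro integrable_const_bound[where B = 1]) auto
  have "expectation (\<lambda>\<omega>. exp (- X \<omega>)) \<noteq> 0"
    using integral_nonneg_eq_0_iff_AE[OF int_exp] not_AE_zero_E by auto
  moreover have "0 \<le> expectation (\<lambda>\<omega>. exp (- X \<omega>))" by (intro integral_nonneg_AE) simp
  ultimately show "0 < expectation (\<lambda>\<omega>. exp (- X \<omega>))" by (metis less_eq_real_def)
  have int': "integrable M (\<lambda>\<omega>. 1 - exp (- X \<omega>))" by (simp add: int_exp)
  have nonneg': "AE \<omega> in M. 0 \<le> 1 - exp (- X \<omega>)" using nonneg by eventually_elim simp
  have "expectation (\<lambda>\<omega>. 1 - exp (- X \<omega>)) \<noteq> 0"
  proof
    assume "expectation (\<lambda>\<omega>. 1 - exp (- X \<omega>)) = 0"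
    then have "AE \<omega> in M. X \<omega> = 0"
      using integral_nonneg_eq_0_iff_AE[OF int' nonneg'] by simp
    then have "expectation X = expectation (\<lambda>_. 0)" by (intro integral_cong_AE) auto
    with mean show False by simp
  qed
  moreover have "0 \<le> expectation (\<lambda>\<omega>. 1 - exp (- X \<omega>))" using nonneg' by (rule integral_nonneg_AE)
  ultimately show "expectation (\<lambda>\<omega>. exp (- X \<omega>)) < 1"
    by (simp add: int_exp prob_space)
qed

lemma (in prob_space) expectation_of_bool:
  assumes [measurable]: "Measurable.pred M P"
  shows "expectation (\<lambda>\<omega>. of_bool (P \<omega>)) = \<P>(\<omega> in M. P \<omega>)"
proof -
  have "expectation (\<lambda>\<omega>. of_bool (P \<omega>)) = (\<integral>\<omega>. indicator {\<omega> \<in> space M. P \<omega>} \<omega> \<partial>M)"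
    by (intro Bochner_Integration.integral_cong) (auto simp: indicator_def)
  also have "\<dots> = prob {\<omega> \<in> space M. P \<omega>}"
    by (simp add: Int_def conj_commute cong: conj_cong)
  finally show ?thesis .
qed

text \<open>
  The sum counts the positive multiples of \<open>\<delta>\<close> below \<open>x\<close>.
\<close>

lemma sum_of_bool_multiples_le:
  fixes x \<delta> :: real
  assumes "\<delta> > 0" "x \<ge> 0"
  shows "(\<Sum>k=1..K. of_bool (\<delta> * real k < x)) \<le> x / \<delta>"
proof -
  have "{k \<in> {1..K}. \<delta> * real k < x} \<subseteq> {1..nat \<lfloor>x / \<delta>\<rfloor>}"
  proof
    fix k assume k: "k \<in> {k \<in> {1..K}. \<delta> * real k < x}"
    then have "real k \<le> x / \<delta>" using assms by (simp add: field_simps)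
    then show "k \<in> {1..nat \<lfloor>x / \<delta>\<rfloor>}" using k by (auto simp: le_nat_floor)
  qed
  then have "card {k \<in> {1..K}. \<delta> * real k < x} \<le> nat \<lfloor>x / \<delta>\<rfloor>"
    using card_mono[of "{1..nat \<lfloor>x / \<delta>\<rfloor>}"] by fastforce
  moreover have "real (nat \<lfloor>x / \<delta>\<rfloor>) \<le> x / \<delta>" using assms by (intro of_nat_floor) simp
  moreover have "(\<Sum>k=1..K. of_bool (\<delta> * real k < x)) = real (card {k \<in> {1..K}. \<delta> * real k < x})"
    by (simp add: of_bool_def sum.If_cases Int_def)
  ultimately show ?thesis by linarith
qed

lemma (in prob_space) sum_tails_le_expectation:
  fixes X :: "'a \<Rightarrow> real"
  assumes int: "integrable M X" and nonneg: "AE \<omega> in M. X \<omega> \<ge> 0" and "\<delta> > 0"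
  shows "(\<Sum>k=1..K. \<P>(\<omega> in M. \<delta> * real k < X \<omega>)) \<le> expectation X / \<delta>"
proof -
  have [measurable]: "random_variable borel X" using int by simp
  have X_pred: "Measurable.pred M (\<lambda>\<omega>. \<delta> * real k < X \<omega>)" for k
    by measurable
  have int': "integrable M (\<lambda>\<omega>. of_bool (\<delta> * real k < X \<omega>) :: real)" for k
    by (rule integrable_const_bound[where B = 1]) auto
  have "(\<Sum>k=1..K. \<P>(\<omega> in M. \<delta> * real k < X \<omega>))
      = (\<integral>\<omega>. (\<Sum>k=1..K. of_bool (\<delta> * real k < X \<omega>)) \<partial>M)"
    by (subst Bochner_Integration.integral_sum) (simp_all only: int' expectation_of_bool X_pred)
  also have "\<dots> \<le> (\<integral>\<omega>. X \<omega> / \<delta> \<partial>M)"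
  proof (rule integral_mono_AE)
    show "AE \<omega> in M. (\<Sum>k=1..K. of_bool (\<delta> * real k < X \<omega>)) \<le> X \<omega> / \<delta>"
      using nonneg by eventually_elim (rule sum_of_bool_multiples_le[OF \<open>\<delta> > 0\<close>])
    show "integrable M (\<lambda>\<omega>. \<Sum>k=1..K. of_bool (\<delta> * real k < X \<omega>) :: real)"
      by (intro Bochner_Integration.integrable_sum int')
  qed (use int in simp)
  finally show ?thesis by simp
qed

lemma sum_int_interval_reversed:
  fixes f :: "nat \<Rightarrow> real" and p n :: int
  shows "(\<Sum>m\<in>{p..<n}. f (nat (n - m))) = (\<Sum>k=1..nat (n - p). f k)"
  by (rule sum.reindex_bij_witness[of _ "\<lambda>k. n - int k" "\<lambda>m. nat (n - m)"]) auto

lemma prod_one_plus_telescope: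
  fixes a :: "int \<Rightarrow> real"
  assumes "p \<le> n"
  shows "(\<Prod>i\<in>{p..<n}. 1 + a i) = 1 + (\<Sum>m\<in>{p..<n}. a m * (\<Prod>i\<in>{p..<m}. 1 + a i))"
  using assms
proof (induction n rule: int_ge_induct)
  case (step n)
  then have "{p..<n + 1} = insert n {p..<n}" by auto
  then show ?case using step by (simp add: algebra_simps)
qed simp

lemma sum_telescope_int:
  fixes f :: "int \<Rightarrow> real"
  assumes "m \<le> n"
  shows "(\<Sum>a\<in>{m<..n}. f a - f (a - 1)) = f n - f m"
  using assms
proof (induction n rule: int_ge_induct)
  case (step n)
  then have "{m<..n + 1} = insert (n + 1) {m<..n}" by auto
  then show ?case using step by simp
qed simp

lemma (in prob_space) iid_expectation:
  assumes "iid X" and [measurable]: "f \<in> borel_measurable borel"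
  shows "expectation (\<lambda>\<omega>. f (X i \<omega>) :: real) = expectation (\<lambda>\<omega>. f (X j \<omega>))"
proof -
  have [measurable]: "random_variable borel (X k)" for k
    using assms(1) by (auto simp: iid_def indep_vars_def)
  have "expectation (\<lambda>\<omega>. f (X k \<omega>)) = (\<integral>x. f x \<partial>distr M borel (X k))" for k
    by (subst integral_distr) auto
  then show ?thesis using assms(1) unfolding iid_def by metis
qed

section \<open>The number of requests present at an arrival\<close>

context loss_network
begin

definition interarrival :: "int \<Rightarrow> 'a \<Rightarrow> real" where
  "interarrival n \<omega> = \<tau> n \<omega> - \<tau> (n - 1) \<omega>"

text \<open>
  All primitive variables in one family, numbered by 0 for interarrival times, 1 for requirements and 2
  for holding times. Independence of derived quantities then only requires them to be read off from disjoint
  sets of indices.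
\<close>

definition source :: "nat \<times> int \<Rightarrow> 'a \<Rightarrow> real" where
  "source = (\<lambda>(k, i). ([interarrival, B, \<theta>] ! k) i)"

lemma source_simps [simp]:
  "source (0, i) = interarrival i" "source (Suc 0, i) = B i" "source (2, i) = \<theta> i"
  by (simp_all add: source_def)

lemma iid_interarrival: "iid interarrival"
  using interarrival_iid unfolding interarrival_def[abs_def] .

lemma indep_source: "indep_vars (\<lambda>_. borel) source ({..<3} \<times> UNIV)"
proof -
  have "indep_vars (\<lambda>_. \<Pi>\<^sub>M n\<in>(UNIV :: int set). (borel :: real measure))
      (\<lambda>k \<omega>. (if k = 0 then (\<lambda>f n. f n - f (n - 1)) else (\<lambda>f. f)) (\<lambda>n. ([\<tau>, B, \<theta>] ! k) n \<omega>)) {..<3}"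
    by (rule indep_vars_compose2[OF sequences_indep]) (auto intro!: measurable_PiM_single')
  also have "?this \<longleftrightarrow> indep_vars (\<lambda>_. \<Pi>\<^sub>M n\<in>(UNIV :: int set). (borel :: real measure))
      (\<lambda>k \<omega> n. ([interarrival, B, \<theta>] ! k) n \<omega>) {..<3}"
    by (intro indep_vars_cong) (auto simp: interarrival_def fun_eq_iff nth_Cons' )
  finally show ?thesis
    unfolding source_def
  proof (rule indep_vars_of_indep_paths)
    show "indep_vars (\<lambda>_. borel) ([interarrival, B, \<theta>] ! k) UNIV" if "k \<in> {..<3}" for k :: nat
      using that iid_interarrival requirement_iid holding_iid
      by (auto simp: iid_def nth_Cons' less_Suc_eq numeral_3_eq_3)
  qed
qed

lemma measurable_source [measurable]:
  "random_variable borel (interarrival i)" "random_variable borel (B i)" "random_variable borel (\<theta> i)"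
  using iid_interarrival requirement_iid holding_iid by (auto simp: iid_def indep_vars_def)

lemma elapsed_eq: "m \<le> n \<Longrightarrow> \<tau> n \<omega> - \<tau> m \<omega> = (\<Sum>a\<in>{m<..n}. interarrival a \<omega>)"
  unfolding interarrival_def by (rule sum_telescope_int[symmetric])

text \<open>
  For \<open>i < n\<close>: request \<open>i\<close>, if it is accepted, is still active when request \<open>n\<close> arrives. The
  elapsed time is written as a sum of interarrival times in order to display which variables it depends on.
\<close>

definition overlaps :: "int \<Rightarrow> int \<Rightarrow> 'a \<Rightarrow> bool" where
  "overlaps i n \<omega> \<longleftrightarrow> \<theta> i \<omega> > (\<Sum>a\<in>{i<..n}. interarrival a \<omega>)"

lemma measurable_overlaps [measurable]: "Measurable.pred M (overlaps i n)"
  unfolding overlaps_def by measurable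

text \<open>
  The product equals \<open>(1 + \<epsilon>)\<close> to the number of indices in \<open>{p..<n}\<close> that overlap \<open>n\<close>; its
  expectation is a truncated generating function of the number of requests present.
\<close>

definition load_weight :: "real \<Rightarrow> int \<Rightarrow> int \<Rightarrow> 'a \<Rightarrow> real" where
  "load_weight \<epsilon> p n \<omega> = (\<Prod>i\<in>{p..<n}. 1 + \<epsilon> * of_bool (overlaps i n \<omega>))"

lemma measurable_load_weight [measurable]: "load_weight \<epsilon> p n \<in> borel_measurable M"
  unfolding load_weight_def by measurable

lemma load_weight_nonneg: "\<epsilon> \<ge> 0 \<Longrightarrow> 0 \<le> load_weight \<epsilon> p n \<omega>"
  unfolding load_weight_def by (intro prod_nonneg) auto

lemma integrable_load_weight:
  assumes "\<epsilon> \<ge> 0"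
  shows "integrable M (load_weight \<epsilon> p n)"
proof (rule integrable_const_bound)
  show "AE \<omega> in M. norm (load_weight \<epsilon> p n \<omega>) \<le> (1 + \<epsilon>) ^ card {p..<n}"
  proof (rule AE_I2)
    fix \<omega>
    have "load_weight \<epsilon> p n \<omega> \<le> (\<Prod>i\<in>{p..<n}. 1 + \<epsilon>)"
      unfolding load_weight_def using assms by (intro prod_mono) auto
    then show "norm (load_weight \<epsilon> p n \<omega>) \<le> (1 + \<epsilon>) ^ card {p..<n}"
      using load_weight_nonneg[OF assms, of p n \<omega>] by simp
  qed
qed measurable

text \<open>
  The event involves the holding time of \<open>m\<close> and the interarrival times after \<open>m\<close>; the weight
  involves holding times before \<open>m\<close> and interarrival times up to \<open>m\<close>.
\<close>

lemma indep_overlaps_load_weight: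
  assumes "m < n"
  shows "indep_var borel (\<lambda>\<omega>. of_bool (overlaps m n \<omega>) :: real) borel (load_weight \<epsilon> p m)"
proof -
  let ?A = "insert (2, m) ({0} \<times> {m<..n}) :: (nat \<times> int) set"
  let ?B = "{2} \<times> {..<m} \<union> {0} \<times> {..m} :: (nat \<times> int) set"
  let ?f = "\<lambda>z. of_bool (z (2, m) > (\<Sum>a\<in>{m<..n}. z (0, a) :: real)) :: real"
  let ?g = "\<lambda>z. (\<Prod>i\<in>{p..<m}. 1 + \<epsilon> * of_bool (z (2, i) > (\<Sum>a\<in>{i<..m}. z (0, a) :: real))) :: real"
  have [measurable]: "(\<lambda>z. \<Sum>a\<in>{m<..n}. z (0, a) :: real) \<in> borel_measurable (\<Pi>\<^sub>M j\<in>?A. borel)"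
    by (intro borel_measurable_sum measurable_component_singleton) auto
  have [measurable]: "(\<lambda>z. z (2, m)) \<in> borel_measurable (\<Pi>\<^sub>M j\<in>?A. (borel :: real measure))"
    by (intro measurable_component_singleton) auto
  have f: "?f \<in> borel_measurable (\<Pi>\<^sub>M j\<in>?A. borel)" by measurable
  have g: "?g \<in> borel_measurable (\<Pi>\<^sub>M j\<in>?B. borel)"
  proof (rule borel_measurable_prod)
    fix i assume i: "i \<in> {p..<m}"
    have [measurable]: "(\<lambda>z. \<Sum>a\<in>{i<..m}. z (0, a) :: real) \<in> borel_measurable (\<Pi>\<^sub>M j\<in>?B. borel)"
      using i by (intro borel_measurable_sum measurable_component_singleton) auto
    have [measurable]: "(\<lambda>z. z (2, i)) \<in> borel_measurable (\<Pi>\<^sub>M j\<in>?B. (borel :: real measure))"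
      using i by (intro measurable_component_singleton) auto
    show "(\<lambda>z. 1 + \<epsilon> * of_bool (z (2, i) > (\<Sum>a\<in>{i<..m}. z (0, a) :: real))) \<in> borel_measurable (\<Pi>\<^sub>M j\<in>?B. borel)"
      by measurable
  qed
  have "indep_var (\<Pi>\<^sub>M j\<in>?A. borel) (\<lambda>\<omega>. restrict (\<lambda>j. source j \<omega>) ?A)
      (\<Pi>\<^sub>M j\<in>?B. borel) (\<lambda>\<omega>. restrict (\<lambda>j. source j \<omega>) ?B)"
    by (rule indep_var_restrict[OF indep_source]) auto
  from indep_var_compose[OF this f g]
  have "indep_var borel (?f \<circ> (\<lambda>\<omega>. restrict (\<lambda>j. source j \<omega>) ?A))
      borel (?g \<circ> (\<lambda>\<omega>. restrict (\<lambda>j. source j \<omega>) ?B))" .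
  also have "?f \<circ> (\<lambda>\<omega>. restrict (\<lambda>j. source j \<omega>) ?A) = (\<lambda>\<omega>. of_bool (overlaps m n \<omega>))"
    by (simp add: fun_eq_iff overlaps_def)
  also have "?g \<circ> (\<lambda>\<omega>. restrict (\<lambda>j. source j \<omega>) ?B) = load_weight \<epsilon> p m"
  proof -
    have "(\<Sum>a\<in>{i<..m}. restrict (\<lambda>j. source j \<omega>) ?B (0, a)) = (\<Sum>a\<in>{i<..m}. interarrival a \<omega>)" for i \<omega>
      by (intro sum.cong) auto
    moreover have "restrict (\<lambda>j. source j \<omega>) ?B (2, i) = \<theta> i \<omega>" if "i < m" for i \<omega>
      using that by simp
    ultimately show ?thesis
      by (auto simp: fun_eq_iff overlaps_def load_weight_def simp del: restrict_apply intro!: prod.cong cong: if_cong)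
  qed
  finally show ?thesis .
qed

lemma interarrivals_nonneg: "AE \<omega> in M. \<forall>n. interarrival n \<omega> \<ge> 0"
  unfolding AE_all_countable interarrival_def using interarrival_nonneg by blast

text \<open>
  If request \<open>m\<close> overlaps \<open>n\<close>, then with \<open>k = n - m\<close> either its holding time exceeds \<open>\<delta> * k\<close>, or
  the sum of \<open>k\<close> interarrival times falls below \<open>\<delta> * k\<close>. The probabilities of the former sum up to at
  most \<open>E \<theta> / \<delta>\<close>, and those of the latter decay geometrically when \<open>\<delta>\<close> is small.
\<close>

lemma overlap_prob_summable:
  obtains U where "U > 0" "\<And>p n. (\<Sum>m\<in>{p..<n}. \<P>(\<omega> in M. overlaps m n \<omega>)) \<le> U"
proof -
  define q where "q = expectation (\<lambda>\<omega>. exp (- interarrival 0 \<omega>))"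
  have "integrable M (interarrival 0)" "expectation (interarrival 0) > 0"
    using interarrival_integrable[of 0] interarrival_mean[of 0] rate_pos
    by (simp_all add: interarrival_def[abs_def])
  moreover have "AE \<omega> in M. interarrival 0 \<omega> \<ge> 0" using interarrivals_nonneg by eventually_elim simp
  ultimately have q: "0 < q" "q < 1"
    unfolding q_def using expectation_exp_neg_less_1[of "interarrival 0"] by auto
  have q_eq: "expectation (\<lambda>\<omega>. exp (- interarrival i \<omega>)) = q" for i
    unfolding q_def by (rule iid_expectation[OF iid_interarrival, where f = "\<lambda>x. exp (- x)"]) measurable
  \<comment> \<open>Any \<open>\<delta> > 0\<close> with \<open>exp \<delta> * q < 1\<close> would do; this one gives the rate \<open>sqrt q\<close>.\<close>
  define \<delta> where "\<delta> = - ln q / 2"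
  define r where "r = exp \<delta> * q"
  have \<delta>: "\<delta> > 0" using q by (simp add: \<delta>_def)
  have "r = exp (\<delta> + ln q)" using q by (simp add: r_def exp_add)
  then have r: "0 < r" "r < 1" using q by (simp_all add: \<delta>_def)
  define f where "f k = \<P>(\<omega> in M. \<delta> * real k < \<theta> 0 \<omega>) + r ^ k" for k
  have le: "\<P>(\<omega> in M. overlaps m n \<omega>) \<le> f (nat (n - m))" if "m < n" for m n
  proof -
    let ?k = "nat (n - m)"
    have "\<P>(\<omega> in M. overlaps m n \<omega>)
        \<le> prob ({\<omega> \<in> space M. \<delta> * real ?k < \<theta> m \<omega>} \<union> {\<omega> \<in> space M. (\<Sum>a\<in>{m<..n}. interarrival a \<omega>) < \<delta> * real ?k})"
      by (intro finite_measure_mono) (auto simp: overlaps_def)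
    also have "\<dots> \<le> \<P>(\<omega> in M. \<delta> * real ?k < \<theta> m \<omega>) + \<P>(\<omega> in M. (\<Sum>a\<in>{m<..n}. interarrival a \<omega>) < \<delta> * real ?k)"
      by (intro measure_Un_le) measurable
    also have "\<P>(\<omega> in M. (\<Sum>a\<in>{m<..n}. interarrival a \<omega>) < \<delta> * real ?k)
        \<le> exp (\<delta> * real ?k) * q ^ card {m<..n}"
    proof (rule prob_sum_less_exponential)
      show "indep_vars (\<lambda>_. borel) interarrival {m<..n}"
        using iid_interarrival unfolding iid_def by (auto intro: indep_vars_subset)
      show "AE \<omega> in M. 0 \<le> interarrival i \<omega>" for i using interarrivals_nonneg by eventually_elim simp
    qed (simp_all add: q_eq)
    also have "exp (\<delta> * real ?k) * q ^ card {m<..n} = r ^ ?k"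
      by (simp add: r_def power_mult_distrib mult.commute[of \<delta>] exp_of_nat_mult)
    also have "\<P>(\<omega> in M. \<delta> * real ?k < \<theta> m \<omega>) = \<P>(\<omega> in M. \<delta> * real ?k < \<theta> 0 \<omega>)"
    proof -
      have "\<P>(\<omega> in M. \<delta> * real ?k < \<theta> i \<omega>) = measure (distr M borel (\<theta> i)) {\<delta> * real ?k<..}" for i
        by (subst measure_distr) (auto intro!: arg_cong[where f = prob])
      then show ?thesis using holding_iid unfolding iid_def by metis
    qed
    finally show ?thesis by (simp add: f_def)
  qed
  have fsum: "(\<Sum>k=1..K. f k) \<le> expectation (\<theta> 0) / \<delta> + 1 / (1 - r)" for K
  proof -
    have "(\<Sum>k=1..K. r ^ k) \<le> (\<Sum>k. r ^ k)"
      using r by (intro sum_le_suminf summable_geometric) auto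
    also have "\<dots> = 1 / (1 - r)" using r by (intro suminf_geometric) auto
    finally show ?thesis
      using sum_tails_le_expectation[OF holding_integrable[of 0] holding_nonneg[of 0] \<delta>, of K]
      by (simp add: f_def sum.distrib)
  qed
  have "(\<Sum>m\<in>{p..<n}. \<P>(\<omega> in M. overlaps m n \<omega>)) \<le> expectation (\<theta> 0) / \<delta> + 1 / (1 - r)" for p n
  proof -
    have "(\<Sum>m\<in>{p..<n}. \<P>(\<omega> in M. overlaps m n \<omega>)) \<le> (\<Sum>m\<in>{p..<n}. f (nat (n - m)))"
      by (intro sum_mono le) auto
    with fsum[of "nat (n - p)"] show ?thesis by (simp add: sum_int_interval_reversed)
  qed
  moreover have "0 < expectation (\<theta> 0) / \<delta> + 1 / (1 - r)"
    using \<delta> r integral_nonneg_AE[OF holding_nonneg[of 0]] by (intro add_nonneg_pos) auto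
  ultimately show ?thesis using that by blast
qed

text \<open>
  Expand the weight according to the last overlapping request \<open>m\<close>. Those before \<open>m\<close> that overlap
  \<open>n\<close> also overlap \<open>m\<close>, since arrival times are nondecreasing, so their weight is at most the weight seen by \<open>m\<close>,
  which is independent of whether \<open>m\<close> overlaps \<open>n\<close>. With \<open>U\<close> bounding the sums of overlap probabilities,
  a bound \<open>c\<close> for shorter intervals gives \<open>1 + \<epsilon> * U * c\<close> for the next one, and \<open>\<epsilon> * U = 1 / 2\<close>,
  \<open>c = 2\<close> is a fixed point.
\<close>

lemma load_weight_bounded:
  obtains \<epsilon> c where "\<epsilon> > 0" "\<And>p n. expectation (load_weight \<epsilon> p n) \<le> c"
proof -
  obtain U where U: "U > 0" "\<And>p n. (\<Sum>m\<in>{p..<n}. \<P>(\<omega> in M. overlaps m n \<omega>)) \<le> U"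
    using overlap_prob_summable by blast
  define \<epsilon> where "\<epsilon> = 1 / (2 * U)"
  have \<epsilon>: "\<epsilon> > 0" "\<epsilon> * U = 1 / 2" using U(1) by (simp_all add: \<epsilon>_def)
  have "expectation (load_weight \<epsilon> p n) \<le> 2" for p n
  proof (induction "nat (n - p)" arbitrary: n rule: less_induct)
    case less
    show ?case
    proof (cases "p \<le> n")
      case False
      then show ?thesis by (simp add: load_weight_def[abs_def] prob_space)
    next
      case True
      let ?I = "\<lambda>m \<omega>. of_bool (overlaps m n \<omega>) :: real"
      have intI: "integrable M (?I m)" for m
        by (rule integrable_const_bound[where B = 1]) auto
      have EI: "expectation (?I m) = \<P>(\<omega> in M. overlaps m n \<omega>)" for m
        by (rule expectation_of_bool) measurable
      have prod_int: "integrable M (\<lambda>\<omega>. ?I m \<omega> * load_weight \<epsilon> p m \<omega>)"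
        and prod_eq: "(\<integral>\<omega>. ?I m \<omega> * load_weight \<epsilon> p m \<omega> \<partial>M)
          = \<P>(\<omega> in M. overlaps m n \<omega>) * expectation (load_weight \<epsilon> p m)" if "m < n" for m
        using indep_var_integrable[OF indep_overlaps_load_weight[OF that] intI integrable_load_weight]
          indep_var_lebesgue_integral[OF indep_overlaps_load_weight[OF that] intI integrable_load_weight]
          \<epsilon> by (simp_all add: EI)
      have "AE \<omega> in M. load_weight \<epsilon> p n \<omega>
          \<le> 1 + (\<Sum>m\<in>{p..<n}. \<epsilon> * (?I m \<omega> * load_weight \<epsilon> p m \<omega>))"
        using interarrivals_nonneg
      proof eventually_elim
        case (elim \<omega>)
        have mono: "overlaps i m \<omega>" if "overlaps i n \<omega>" "i < m" "m < n" for i m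
        proof -
          have "(\<Sum>a\<in>{i<..m}. interarrival a \<omega>) \<le> (\<Sum>a\<in>{i<..n}. interarrival a \<omega>)"
            using that elim by (intro sum_mono2) auto
          then show ?thesis using that(1) by (simp add: overlaps_def)
        qed
        have "load_weight \<epsilon> p n \<omega>
            = 1 + (\<Sum>m\<in>{p..<n}. \<epsilon> * ?I m \<omega> * (\<Prod>i\<in>{p..<m}. 1 + \<epsilon> * ?I i \<omega>))"
          unfolding load_weight_def by (rule prod_one_plus_telescope[OF True])
        also have "\<dots> \<le> 1 + (\<Sum>m\<in>{p..<n}. \<epsilon> * (?I m \<omega> * load_weight \<epsilon> p m \<omega>))"
          unfolding load_weight_def mult.assoc using \<epsilon> mono
          by (intro add_left_mono sum_mono mult_left_mono prod_mono conjI) auto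
        finally show ?case .
      qed
      then have "expectation (load_weight \<epsilon> p n)
          \<le> (\<integral>\<omega>. 1 + (\<Sum>m\<in>{p..<n}. \<epsilon> * (?I m \<omega> * load_weight \<epsilon> p m \<omega>)) \<partial>M)"
        using \<epsilon> by (intro integral_mono_AE integrable_load_weight Bochner_Integration.integrable_add
            Bochner_Integration.integrable_sum integrable_mult_right prod_int) auto
      also have "\<dots> = 1 + (\<Sum>m\<in>{p..<n}. \<epsilon> * (\<P>(\<omega> in M. overlaps m n \<omega>) * expectation (load_weight \<epsilon> p m)))"
        by (subst Bochner_Integration.integral_add)
           (auto simp: prob_space prod_int prod_eq Bochner_Integration.integral_sum
             intro!: Bochner_Integration.integrable_sum integrable_mult_right prod_int)
      also have "\<dots> \<le> 1 + (\<Sum>m\<in>{p..<n}. \<epsilon> * (\<P>(\<omega> in M. overlaps m n \<omega>) * 2))"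
        using \<epsilon> less by (intro add_left_mono sum_mono mult_left_mono) auto
      also have "\<dots> = 1 + 2 * \<epsilon> * (\<Sum>m\<in>{p..<n}. \<P>(\<omega> in M. overlaps m n \<omega>))"
        by (simp add: sum_distrib_left mult_ac)
      also have "\<dots> \<le> 1 + 2 * \<epsilon> * U"
        using \<epsilon> U(2) by (intro add_left_mono mult_left_mono) auto
      finally show ?thesis using \<epsilon> by simp
    qed
  qed
  with \<epsilon>(1) show ?thesis by (rule that)
qed

end

text \<open>
  Fubini for an event that depends on two independent variables, the first only through a countably
  valued function \<open>f\<close>. Countability reduces joint measurability to that of the sections.
\<close>

lemma (in prob_space) prob_indep_countable:
  fixes P :: "'i \<Rightarrow> 'b \<Rightarrow> bool"
  assumes indep: "indep_var S X N Y" and I: "countable I" and f: "f \<in> measurable S (count_space I)"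
    and P: "\<And>i. i \<in> I \<Longrightarrow> Measurable.pred N (P i)"
  shows "\<P>(\<omega> in M. P (f (X \<omega>)) (Y \<omega>)) = expectation (\<lambda>\<omega>. \<P>(\<omega>' in M. P (f (X \<omega>)) (Y \<omega>')))"
proof -
  have X [measurable]: "X \<in> measurable M S" and Y [measurable]: "Y \<in> measurable M N"
    and joint: "distr M S X \<Otimes>\<^sub>M distr M N Y = distr M (S \<Otimes>\<^sub>M N) (\<lambda>\<omega>. (X \<omega>, Y \<omega>))"
    using indep by (auto simp: indep_var_distribution_eq)
  interpret DY: prob_space "distr M N Y" by (rule prob_space_distr) measurable
  let ?E = "{z \<in> space (S \<Otimes>\<^sub>M N). P (f (fst z)) (snd z)}"
  have "Measurable.pred (count_space I \<Otimes>\<^sub>M N) (\<lambda>z. P (fst z) (snd z))"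
    by (intro measurable_pair_measure_countable1[OF I]) (simp add: P)
  moreover have "(\<lambda>z. (f (fst z), snd z)) \<in> measurable (S \<Otimes>\<^sub>M N) (count_space I \<Otimes>\<^sub>M N)"
    using f by measurable
  ultimately have "Measurable.pred (S \<Otimes>\<^sub>M N) (\<lambda>z. P (f (fst z)) (snd z))"
    using measurable_compose[of "\<lambda>z. (f (fst z), snd z)" _ _ "\<lambda>z. P (fst z) (snd z)"] by simp
  then have E: "?E \<in> sets (S \<Otimes>\<^sub>M N)" by (rule predE)
  have XS: "X \<omega> \<in> space S" if "\<omega> \<in> space M" for \<omega> using measurable_space[OF X that] .
  have YN: "Y \<omega> \<in> space N" if "\<omega> \<in> space M" for \<omega> using measurable_space[OF Y that] .
  have sect: "emeasure (distr M N Y) (Pair (X \<omega>) -` ?E) = ennreal (\<P>(\<omega>' in M. P (f (X \<omega>)) (Y \<omega>')))"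
    if "\<omega> \<in> space M" for \<omega>
  proof -
    have "Pair (X \<omega>) -` ?E \<in> sets N" using sets_Pair1[OF E] .
    then have "emeasure (distr M N Y) (Pair (X \<omega>) -` ?E) = emeasure M (Y -` (Pair (X \<omega>) -` ?E) \<inter> space M)"
      by (simp add: emeasure_distr)
    also have "Y -` (Pair (X \<omega>) -` ?E) \<inter> space M = {\<omega>' \<in> space M. P (f (X \<omega>)) (Y \<omega>')}"
      using that XS YN by (auto simp: space_pair_measure)
    finally show ?thesis by (simp add: emeasure_eq_measure)
  qed
  have sec_meas: "(\<lambda>\<omega>. \<P>(\<omega>' in M. P (f (X \<omega>)) (Y \<omega>'))) \<in> borel_measurable M"
    by (rule measurable_compose[OF measurable_compose[OF X f]]) simp
  have "ennreal (\<P>(\<omega> in M. P (f (X \<omega>)) (Y \<omega>))) = emeasure (distr M (S \<Otimes>\<^sub>M N) (\<lambda>\<omega>. (X \<omega>, Y \<omega>))) ?E"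
    using E XS YN by (subst emeasure_distr)
      (auto simp: emeasure_eq_measure space_pair_measure intro!: arg_cong[where f = prob])
  also have "\<dots> = (\<integral>\<^sup>+x. emeasure (distr M N Y) (Pair x -` ?E) \<partial>distr M S X)"
    unfolding joint[symmetric] using E by (intro DY.emeasure_pair_measure_alt) (simp cong: sets_pair_measure_cong)
  also have "\<dots> = (\<integral>\<^sup>+\<omega>. emeasure (distr M N Y) (Pair (X \<omega>) -` ?E) \<partial>M)"
    using DY.measurable_emeasure_Pair[of ?E S] E
    by (intro nn_integral_distr X) (simp cong: sets_pair_measure_cong)
  also have "\<dots> = (\<integral>\<^sup>+\<omega>. ennreal (\<P>(\<omega>' in M. P (f (X \<omega>)) (Y \<omega>'))) \<partial>M)"
    by (intro nn_integral_cong sect)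
  also have "\<dots> = ennreal (expectation (\<lambda>\<omega>. \<P>(\<omega>' in M. P (f (X \<omega>)) (Y \<omega>'))))"
    by (intro nn_integral_eq_integral integrable_const_bound[where B = 1] sec_meas AE_I2) simp_all
  finally show ?thesis by (subst (asm) ennreal_inj) (auto intro: integral_nonneg_AE)
qed

context loss_network
begin

definition present :: "int \<Rightarrow> 'a \<Rightarrow> int set" where
  "present n \<omega> = {i. i < n \<and> overlaps i n \<omega>}"

text \<open>
  The set is finite almost surely; replacing it by the empty set otherwise makes it a random variable in the
  countable space of finite sets of indices.
\<close>

definition present_fin :: "int \<Rightarrow> 'a \<Rightarrow> int set" where
  "present_fin n \<omega> = (if finite (present n \<omega>) then present n \<omega> else {})"

lemma present_fin_properties: "finite (present_fin n \<omega>)" "n \<notin> present_fin n \<omega>"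
  by (auto simp: present_fin_def present_def)

text \<open>
  The overlap probabilities are summable, so Borel--Cantelli leaves only finitely many overlapping requests.
\<close>

lemma eventually_overlaps_False:
  "AE \<omega> in M. \<exists>K. \<forall>k\<ge>K. \<not> overlaps (n - int (Suc k)) n \<omega>"
proof -
  obtain U where "U > 0" and U: "\<And>p n. (\<Sum>m\<in>{p..<n}. \<P>(\<omega> in M. overlaps m n \<omega>)) \<le> U"
    using overlap_prob_summable by blast
  let ?A = "\<lambda>k. {\<omega> \<in> space M. overlaps (n - int (Suc k)) n \<omega>}"
  have "summable (\<lambda>k. prob (?A k))"
  proof (rule summableI_nonneg_bounded)
    fix K
    have "(\<Sum>k<K. prob (?A k)) = (\<Sum>m\<in>{n - int K..<n}. \<P>(\<omega> in M. overlaps m n \<omega>))"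
      by (rule sum.reindex_bij_witness[of _ "\<lambda>m. nat (n - 1 - m)" "\<lambda>k. n - int (Suc k)"]) auto
    then show "(\<Sum>k<K. prob (?A k)) \<le> U" using U by simp
  qed simp
  then have "AE \<omega> in M. eventually (\<lambda>k. \<omega> \<in> space M - ?A k) sequentially"
    by (intro borel_cantelli_AE1) (auto simp: emeasure_eq_measure)
  then show ?thesis
    by eventually_elim (auto simp: eventually_sequentially)
qed

lemma present_subset_if_eventually:
  assumes "\<forall>k\<ge>K. \<not> overlaps (n - int (Suc k)) n \<omega>"
  shows "present n \<omega> \<subseteq> {n - int K..<n}"
proof
  fix i assume i: "i \<in> present n \<omega>"
  show "i \<in> {n - int K..<n}"
  proof (rule ccontr)
    assume "i \<notin> {n - int K..<n}"
    then have "nat (n - 1 - i) \<ge> K" "n - int (Suc (nat (n - 1 - i))) = i"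
      using i by (auto simp: present_def)
    then show False using assms[rule_format, of "nat (n - 1 - i)"] i by (simp add: present_def)
  qed
qed

lemma finite_present: "AE \<omega> in M. finite (present n \<omega>)"
  using eventually_overlaps_False[of n]
  by eventually_elim (meson finite_atLeastLessThan_int finite_subset present_subset_if_eventually)

text \<open>
  The present requests are determined by interarrival and holding times, so the requirements may be
  averaged separately with the index set held fixed.
\<close>

lemma measurable_present_fin: "present_fin n \<in> measurable M (count_space (Collect finite))"
  and prob_present_requirements:
    "(\<And>J. finite J \<Longrightarrow> Measurable.pred (\<Pi>\<^sub>M i\<in>UNIV. borel) (P J)) \<Longrightarrow>
      \<P>(\<omega> in M. P (present_fin n \<omega>) (\<lambda>i. B i \<omega>))
      = expectation (\<lambda>\<omega>. \<P>(\<omega>' in M. P (present_fin n \<omega>) (\<lambda>i. B i \<omega>')))"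
proof -
  let ?A = "{0, 2} \<times> UNIV :: (nat \<times> int) set"
  let ?B = "{Suc 0} \<times> UNIV :: (nat \<times> int) set"
  define A where "A z = {i. i < n \<and> z (2, i) > (\<Sum>a\<in>{i<..n}. z (0, a))}" for z :: "nat \<times> int \<Rightarrow> real"
  let ?f = "\<lambda>z. if finite (A z) then A z else {}"
  let ?g = "\<lambda>z i. z (Suc 0, i) :: real"
  have f: "?f \<in> measurable (\<Pi>\<^sub>M j\<in>?A. borel) (count_space (Collect finite))"
  proof (subst measurable_count_space_eq_countable, safe)
    show "countable (Collect finite :: int set set)" by (rule countable_Collect_finite)
    fix J :: "int set"
    have [measurable]: "Measurable.pred (\<Pi>\<^sub>M j\<in>?A. borel) (\<lambda>z. i \<in> A z)" for i
    proof -
      have [measurable]: "(\<lambda>z. \<Sum>a\<in>{i<..n}. z (0, a) :: real) \<in> borel_measurable (\<Pi>\<^sub>M j\<in>?A. borel)"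
        by (intro borel_measurable_sum measurable_component_singleton) auto
      have [measurable]: "(\<lambda>z. z (2, i)) \<in> borel_measurable (\<Pi>\<^sub>M j\<in>?A. (borel :: real measure))"
        by (intro measurable_component_singleton) auto
      show ?thesis unfolding A_def mem_Collect_eq by measurable
    qed
    \<comment> \<open>Finiteness as a countable combination of membership events: the set is bounded above by \<open>n\<close>.\<close>
    have fin: "finite (A z) \<longleftrightarrow> (\<exists>k. \<forall>i. i < k \<longrightarrow> i \<notin> A z)" for z
    proof
      assume "finite (A z)"
      then have "\<forall>i. i < Min (insert 0 (A z)) \<longrightarrow> i \<notin> A z" by (auto simp: not_less)
      then show "\<exists>k. \<forall>i. i < k \<longrightarrow> i \<notin> A z" by blast
    next
      assume "\<exists>k. \<forall>i. i < k \<longrightarrow> i \<notin> A z"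
      then obtain k where k: "\<And>i. i < k \<Longrightarrow> i \<notin> A z" by blast
      have "A z \<subseteq> {k..<n}"
      proof
        fix i assume "i \<in> A z"
        moreover from this have "i < n" by (simp add: A_def)
        ultimately show "i \<in> {k..<n}" using k[of i] by force
      qed
      then show "finite (A z)" by (rule finite_subset) simp
    qed
    have f_iff: "?f z = J \<longleftrightarrow> ((\<exists>k. \<forall>i. i < k \<longrightarrow> i \<notin> A z) \<and> (\<forall>i. i \<in> A z \<longleftrightarrow> i \<in> J)) \<or>
        (\<not> (\<exists>k. \<forall>i. i < k \<longrightarrow> i \<notin> A z) \<and> J = {})" for z
      unfolding fin[symmetric] set_eq_iff[symmetric] by (cases "finite (A z)") auto
    have "Measurable.pred (\<Pi>\<^sub>M j\<in>?A. borel) (\<lambda>z. ?f z = J)"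
      unfolding f_iff by measurable
    moreover have "?f -` {J} \<inter> space (\<Pi>\<^sub>M j\<in>?A. borel) = {z \<in> space (\<Pi>\<^sub>M j\<in>?A. borel). ?f z = J}"
      by blast
    ultimately show "?f -` {J} \<inter> space (\<Pi>\<^sub>M j\<in>?A. borel) \<in> sets (\<Pi>\<^sub>M j\<in>?A. borel)"
      by (simp only: predE)
  qed auto
  have g: "?g \<in> measurable (\<Pi>\<^sub>M j\<in>?B. borel) (\<Pi>\<^sub>M i\<in>(UNIV :: int set). borel)"
    by (intro measurable_PiM_single') (auto intro!: measurable_component_singleton)
  have indep: "indep_var (\<Pi>\<^sub>M j\<in>?A. borel) (\<lambda>\<omega>. restrict (\<lambda>j. source j \<omega>) ?A)
      (\<Pi>\<^sub>M j\<in>?B. borel) (\<lambda>\<omega>. restrict (\<lambda>j. source j \<omega>) ?B)"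
    by (rule indep_var_restrict[OF indep_source]) auto
  have f_eq: "?f (restrict (\<lambda>j. source j \<omega>) ?A) = present_fin n \<omega>" for \<omega>
    by (simp add: A_def overlaps_def present_def present_fin_def)
  have g_eq: "?g (restrict (\<lambda>j. source j \<omega>) ?B) = (\<lambda>i. B i \<omega>)" for \<omega>
    by simp
  show "present_fin n \<in> measurable M (count_space (Collect finite))"
    using measurable_compose[OF indep_var_rv1[OF indep] f] unfolding f_eq .
  assume P: "\<And>J. finite J \<Longrightarrow> Measurable.pred (\<Pi>\<^sub>M i\<in>UNIV. borel) (P J)"
  have "Measurable.pred (\<Pi>\<^sub>M j\<in>?B. borel) (\<lambda>z. P J (?g z))" if "J \<in> Collect finite" for J
    using measurable_compose[OF g P[of J]] that by simp
  from prob_indep_countable[OF indep countable_Collect_finite f, of "\<lambda>J z. P J (?g z)", OF this]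
  show "\<P>(\<omega> in M. P (present_fin n \<omega>) (\<lambda>i. B i \<omega>))
      = expectation (\<lambda>\<omega>. \<P>(\<omega>' in M. P (present_fin n \<omega>) (\<lambda>i. B i \<omega>')))"
    unfolding f_eq g_eq .
qed

text \<open>
  Monotone convergence of the weights over \<open>{n - k..<n}\<close>. Only some \<open>\<epsilon> > 0\<close> can be expected: if
  interarrival times vanish with positive probability, the number of simultaneous arrivals has a geometric
  tail.
\<close>

lemma present_exponential_moment:
  obtains \<epsilon> :: real where "\<epsilon> > 0" "integrable M (\<lambda>\<omega>. (1 + \<epsilon>) ^ card (present_fin n \<omega>))"
proof -
  obtain \<epsilon> c where \<epsilon>: "\<epsilon> > 0" and c: "\<And>p n. expectation (load_weight \<epsilon> p n) \<le> c"
    using load_weight_bounded by blast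
  have "integrable M (\<lambda>\<omega>. (1 + \<epsilon>) ^ card (present_fin n \<omega>))"
  proof -
    let ?f = "\<lambda>k. load_weight \<epsilon> (n - int k) n"
    have mono: "?f k \<omega> \<le> ?f l \<omega>" if "k \<le> l" for k l \<omega>
      unfolding load_weight_def using that \<epsilon> by (intro prod_mono2) auto
    have inc: "incseq (\<lambda>k. expectation (?f k))"
      using \<epsilon> by (intro incseq_SucI integral_mono integrable_load_weight mono) auto
    have "\<forall>k. expectation (?f k) \<le> c" using c by simp
    from incseq_convergent[OF inc this]
    obtain L where L: "(\<lambda>k. expectation (?f k)) \<longlonglongrightarrow> L" by blast
    have lim: "AE \<omega> in M. (\<lambda>k. ?f k \<omega>) \<longlonglongrightarrow> (1 + \<epsilon>) ^ card (present_fin n \<omega>)"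
      using eventually_overlaps_False[of n]
    proof eventually_elim
      case (elim \<omega>)
      then obtain K where sub: "present n \<omega> \<subseteq> {n - int K..<n}"
        using present_subset_if_eventually by blast
      then have fin: "finite (present n \<omega>)" by (rule finite_subset) simp
      have "?f k \<omega> = (1 + \<epsilon>) ^ card (present_fin n \<omega>)" if "k \<ge> K" for k
      proof -
        have "?f k \<omega> = (\<Prod>i\<in>present n \<omega>. 1 + \<epsilon>)"
          unfolding load_weight_def using sub that
          by (intro prod.mono_neutral_cong_right) (auto simp: present_def)
        then show ?thesis using fin by (simp add: present_fin_def)
      qed
      then have "eventually (\<lambda>k. ?f k \<omega> = (1 + \<epsilon>) ^ card (present_fin n \<omega>)) sequentially"
        by (auto simp: eventually_sequentially)
      then show ?case by (rule tendsto_eventually)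
    qed
    show ?thesis
    proof (rule integrable_monotone_convergence[OF _ _ lim L])
      show "(\<lambda>\<omega>. (1 + \<epsilon>) ^ card (present_fin n \<omega>)) \<in> borel_measurable M"
        by (rule measurable_compose[OF measurable_present_fin]) simp
    qed (use mono \<epsilon> in \<open>auto simp: incseq_def intro: integrable_load_weight\<close>)
  qed
  with \<epsilon> show ?thesis by (rule that)
qed

end

section \<open>Sums in which all summands but one are cut off\<close>

text \<open>
  A sum of positive terms exceeds \<open>x\<close> as soon as one term does, so the event that the maximum exceeds
  \<open>x\<close> may be removed from the event that the sum does by subtracting probabilities.
\<close>

lemma (in prob_space) prob_sum_greater_le_excess:
  fixes X :: "'i \<Rightarrow> 'a \<Rightarrow> real"
  assumes I: "finite I" "I \<noteq> {}" and indep: "indep_vars (\<lambda>_. borel) X I"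
    and D: "\<And>i. i \<in> I \<Longrightarrow> distr M borel (X i) = D" and "positive_law D"
    and pos: "\<And>i. i \<in> I \<Longrightarrow> AE \<omega> in M. X i \<omega> > 0"
  shows "\<P>(\<omega> in M. (\<Sum>i\<in>I. X i \<omega>) > x \<and> (\<forall>i\<in>I. X i \<omega> \<le> x)) \<le> positive_law.excess D (card I) x"
proof -
  interpret D: positive_law D by fact
  have [measurable]: "random_variable borel (X i)" if "i \<in> I" for i
    using indep that by (auto simp: indep_vars_def)
  have pos': "AE \<omega> in M. \<forall>i\<in>I. X i \<omega> > 0" using pos I by (simp add: AE_finite_all)
  have [measurable]: "Measurable.pred M (\<lambda>\<omega>. (\<Sum>i\<in>I. X i \<omega>) > x)"
    "Measurable.pred M (\<lambda>\<omega>. \<forall>i\<in>I. X i \<omega> \<le> x)"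
    using I by (measurable; simp)+
  have all: "\<P>(\<omega> in M. \<forall>i\<in>I. X i \<omega> \<le> x) = cdf D x ^ card I"
  proof -
    have "\<P>(\<omega> in M. \<forall>i\<in>I. X i \<omega> \<le> x) = prob (\<Inter>i\<in>I. X i -` {..x} \<inter> space M)"
      using I by (intro arg_cong[where f = prob]) auto
    also have "\<dots> = (\<Prod>i\<in>I. prob (X i -` {..x} \<inter> space M))"
      using I indep by (intro indep_varsD_finite) auto
    also have "\<dots> = (\<Prod>i\<in>I. cdf D x)"
    proof (rule prod.cong[OF refl])
      fix i assume "i \<in> I"
      then show "prob (X i -` {..x} \<inter> space M) = cdf D x"
        by (subst D[symmetric], assumption) (simp add: cdf_def measure_distr)
    qed
    finally show ?thesis by simp
  qed
  have "\<P>(\<omega> in M. (\<Sum>i\<in>I. X i \<omega>) > x \<and> (\<forall>i\<in>I. X i \<omega> \<le> x)) + \<P>(\<omega> in M. \<not> (\<forall>i\<in>I. X i \<omega> \<le> x))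
      = prob ({\<omega> \<in> space M. (\<Sum>i\<in>I. X i \<omega>) > x \<and> (\<forall>i\<in>I. X i \<omega> \<le> x)} \<union> {\<omega> \<in> space M. \<not> (\<forall>i\<in>I. X i \<omega> \<le> x)})"
    by (intro finite_measure_Union[symmetric]) (measurable, auto)
  also have "\<dots> \<le> \<P>(\<omega> in M. (\<Sum>i\<in>I. X i \<omega>) > x)"
  proof (rule finite_measure_mono_AE)
    show "AE \<omega> in M. \<omega> \<in> {\<omega> \<in> space M. (\<Sum>i\<in>I. X i \<omega>) > x \<and> (\<forall>i\<in>I. X i \<omega> \<le> x)} \<union> {\<omega> \<in> space M. \<not> (\<forall>i\<in>I. X i \<omega> \<le> x)}
        \<longrightarrow> \<omega> \<in> {\<omega> \<in> space M. (\<Sum>i\<in>I. X i \<omega>) > x}"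
      using pos'
    proof eventually_elim
      case (elim \<omega>)
      have "(\<Sum>i\<in>I. X i \<omega>) > x" if "j \<in> I" "X j \<omega> > x" for j
        using that I elim member_le_sum[of j I "\<lambda>i. X i \<omega>"] by force
      then show ?case by (auto simp: not_le)
    qed
  qed measurable
  also have "\<P>(\<omega> in M. \<not> (\<forall>i\<in>I. X i \<omega> \<le> x)) = 1 - cdf D x ^ card I"
    by (subst prob_neg) (auto simp: all)
  also have "\<P>(\<omega> in M. (\<Sum>i\<in>I. X i \<omega>) > x) = conv_tail D (card I) x"
    using I(1) indep D by (rule prob_iid_sum_greater)
  finally show ?thesis by (simp add: D.excess_def)
qed

definition truncated_sum :: "('i \<Rightarrow> real) \<Rightarrow> real \<Rightarrow> 'i set \<Rightarrow> real" where
  "truncated_sum b c J = (\<Sum>i\<in>J. if b i \<le> c then b i else 0)"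

text \<open>
  The term \<open>X n\<close> is kept whole and the others are cut to zero above \<open>x\<close>. When the total exceeds \<open>x\<close>,
  one of three things happens: \<open>X n\<close> alone exceeds \<open>x\<close>; no summand does but the full sum does, which the
  excess measures; or some cut summand exceeds \<open>x\<close> and the remaining ones still sum to more than \<open>x\<close>, which
  has probability of smaller order than the tail. The middle bound, by the full sum, is crude but
  uniform once combined with Kesten's bound.
\<close>

lemma (in prob_space) prob_truncated_sum_bounds:
  fixes X :: "'i \<Rightarrow> 'a \<Rightarrow> real" and x :: real
  assumes J: "finite J" "n \<notin> J" and indep: "indep_vars (\<lambda>_. borel) X (insert n J)"
    and D: "\<And>i. i \<in> insert n J \<Longrightarrow> distr M borel (X i) = D" and "positive_law D"
    and pos: "\<And>i. i \<in> insert n J \<Longrightarrow> AE \<omega> in M. X i \<omega> > 0"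
  defines "p \<equiv> \<P>(\<omega> in M. X n \<omega> + truncated_sum (\<lambda>i. X i \<omega>) x J > x)"
  shows "conv_tail D (Suc 0) x \<le> p"
    and "p \<le> conv_tail D (Suc (card J)) x"
    and "p \<le> conv_tail D (Suc 0) x + positive_law.excess D (Suc (card J)) x
              + real (card J) * (conv_tail D (Suc 0) x * conv_tail D (card J) x)"
proof -
  let ?I = "insert n J"
  interpret D: positive_law D by fact
  have rv [measurable]: "random_variable borel (X i)" if "i \<in> ?I" for i
    using indep that by (auto simp: indep_vars_def)
  have pos': "AE \<omega> in M. \<forall>i\<in>?I. X i \<omega> > 0" using pos J by (subst AE_finite_all) auto
  have sum_meas [measurable]: "random_variable borel (\<lambda>\<omega>. \<Sum>i\<in>S. X i \<omega>)" if "S \<subseteq> ?I" for S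
    using that by (intro borel_measurable_sum rv) auto
  have [measurable]: "random_variable borel (\<lambda>\<omega>. truncated_sum (\<lambda>i. X i \<omega>) x J)"
    unfolding truncated_sum_def
  proof (rule borel_measurable_sum)
    fix i assume "i \<in> J"
    then have [measurable]: "random_variable borel (X i)" by (simp add: rv)
    show "random_variable borel (\<lambda>\<omega>. if X i \<omega> \<le> x then X i \<omega> else 0)" by measurable
  qed
  have [measurable]: "random_variable borel (X n)" by (simp add: rv)
  have trunc_le: "truncated_sum (\<lambda>i. X i \<omega>) x S \<le> (\<Sum>i\<in>S. X i \<omega>)"
    and trunc_nonneg: "0 \<le> truncated_sum (\<lambda>i. X i \<omega>) x S"
    if "\<forall>i\<in>?I. X i \<omega> > 0" "S \<subseteq> J" for \<omega> S
    unfolding truncated_sum_def using that by (auto intro!: sum_mono sum_nonneg simp: subset_iff less_imp_le)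
  have single: "\<P>(\<omega> in M. X i \<omega> > x) = conv_tail D (Suc 0) x" if "i \<in> ?I" for i
    using prob_iid_sum_greater[of "{i}" X D x] indep D that indep_vars_subset[OF indep, of "{i}"] by simp
  show "conv_tail D (Suc 0) x \<le> p"
    unfolding single[of n, OF insertI1, symmetric] p_def
  proof (rule finite_measure_mono_AE)
    show "AE \<omega> in M. \<omega> \<in> {\<omega> \<in> space M. x < X n \<omega>} \<longrightarrow>
        \<omega> \<in> {\<omega> \<in> space M. x < X n \<omega> + truncated_sum (\<lambda>i. X i \<omega>) x J}"
      using pos' by eventually_elim (use trunc_nonneg[of _ J] in force)
  qed measurable
  have "p \<le> \<P>(\<omega> in M. (\<Sum>i\<in>?I. X i \<omega>) > x)"
    unfolding p_def
  proof (rule finite_measure_mono_AE)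
    show "AE \<omega> in M. \<omega> \<in> {\<omega> \<in> space M. x < X n \<omega> + truncated_sum (\<lambda>i. X i \<omega>) x J} \<longrightarrow>
        \<omega> \<in> {\<omega> \<in> space M. x < (\<Sum>i\<in>?I. X i \<omega>)}"
      using pos' by eventually_elim (use J trunc_le[of _ J] in force)
  qed (use sum_meas[of ?I] in measurable)
  also have "\<dots> = conv_tail D (Suc (card J)) x"
    using prob_iid_sum_greater[OF _ indep D, of x] J by simp
  finally show "p \<le> conv_tail D (Suc (card J)) x" .

  let ?E1 = "{\<omega> \<in> space M. X n \<omega> > x}"
  let ?E2 = "{\<omega> \<in> space M. (\<Sum>i\<in>?I. X i \<omega>) > x \<and> (\<forall>i\<in>?I. X i \<omega> \<le> x)}"
  let ?E3 = "\<lambda>j. {\<omega> \<in> space M. X j \<omega> > x \<and> (\<Sum>i\<in>?I - {j}. X i \<omega>) > x}"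
  have E1: "?E1 \<in> events" by measurable
  have E2: "?E2 \<in> events"
  proof -
    have [measurable]: "Measurable.pred M (\<lambda>\<omega>. \<forall>i\<in>?I. X i \<omega> \<le> x)"
      using J by (intro pred_intros_finite) auto
    show ?thesis using sum_meas[of ?I] by measurable
  qed
  have E3: "?E3 j \<in> events" if "j \<in> J" for j
  proof -
    have [measurable]: "random_variable borel (X j)" "random_variable borel (\<lambda>\<omega>. \<Sum>i\<in>?I - {j}. X i \<omega>)"
      using that by (auto intro!: rv sum_meas)
    show ?thesis by measurable
  qed
  have "p \<le> prob (?E1 \<union> ?E2 \<union> (\<Union>j\<in>J. ?E3 j))"
    unfolding p_def
  proof (rule finite_measure_mono_AE)
    show "AE \<omega> in M. \<omega> \<in> {\<omega> \<in> space M. x < X n \<omega> + truncated_sum (\<lambda>i. X i \<omega>) x J} \<longrightarrow>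
        \<omega> \<in> ?E1 \<union> ?E2 \<union> (\<Union>j\<in>J. ?E3 j)"
      using pos'
    proof (eventually_elim, intro impI)
      fix \<omega>
      assume pos\<omega>: "\<forall>i\<in>?I. X i \<omega> > 0"
        and "\<omega> \<in> {\<omega> \<in> space M. x < X n \<omega> + truncated_sum (\<lambda>i. X i \<omega>) x J}"
      then have \<omega>: "\<omega> \<in> space M" "x < X n \<omega> + truncated_sum (\<lambda>i. X i \<omega>) x J" by auto
      consider "x < X n \<omega>" | "\<forall>i\<in>?I. X i \<omega> \<le> x" | j where "j \<in> J" "X j \<omega> > x" "X n \<omega> \<le> x"
        by (force simp: not_le)
      then show "\<omega> \<in> ?E1 \<union> ?E2 \<union> (\<Union>j\<in>J. ?E3 j)"
      proof cases
        case 1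
        then show ?thesis using \<omega> by simp
      next
        case 2
        have "x < (\<Sum>i\<in>?I. X i \<omega>)" using \<omega>(2) J trunc_le[OF pos\<omega>, of J] by simp
        then show ?thesis using 2 \<omega>(1) by simp
      next
        case 3
        have "truncated_sum (\<lambda>i. X i \<omega>) x J = truncated_sum (\<lambda>i. X i \<omega>) x (J - {j})"
          using J 3 by (simp add: truncated_sum_def sum.remove)
        also have "\<dots> \<le> (\<Sum>i\<in>J - {j}. X i \<omega>)" by (rule trunc_le[OF pos\<omega>]) auto
        finally have "x < X n \<omega> + (\<Sum>i\<in>J - {j}. X i \<omega>)" using \<omega>(2) by simp
        also have "\<dots> = (\<Sum>i\<in>?I - {j}. X i \<omega>)"
          using J 3 by (subst insert_Diff_if) auto
        finally show ?thesis using 3 \<omega>(1) by auto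
      qed
    qed
    show "?E1 \<union> ?E2 \<union> (\<Union>j\<in>J. ?E3 j) \<in> events"
      by (intro sets.Un sets.finite_UN E1 E2 E3 J)
  qed
  also have "\<dots> \<le> prob ?E1 + prob ?E2 + (\<Sum>j\<in>J. prob (?E3 j))"
  proof -
    have "prob (?E1 \<union> ?E2 \<union> (\<Union>j\<in>J. ?E3 j)) \<le> prob (?E1 \<union> ?E2) + prob (\<Union>j\<in>J. ?E3 j)"
      by (intro measure_Un_le sets.Un sets.finite_UN E1 E2 E3 J)
    moreover have "prob (?E1 \<union> ?E2) \<le> prob ?E1 + prob ?E2"
      by (intro measure_Un_le E1 E2)
    moreover have "prob (\<Union>j\<in>J. ?E3 j) \<le> (\<Sum>j\<in>J. prob (?E3 j))"
      using E3 by (intro finite_measure_subadditive_finite J image_subsetI)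
    ultimately show ?thesis by linarith
  qed
  also have "prob ?E1 = conv_tail D (Suc 0) x" by (simp add: single)
  also have "prob ?E2 \<le> D.excess (Suc (card J)) x"
    using prob_sum_greater_le_excess[OF _ _ indep D \<open>positive_law D\<close> pos, of x] J by simp
  finally have le: "p \<le> conv_tail D (Suc 0) x + D.excess (Suc (card J)) x + (\<Sum>j\<in>J. prob (?E3 j))"
    by simp
  have "prob (?E3 j) = conv_tail D (Suc 0) x * conv_tail D (card J) x" if "j \<in> J" for j
  proof -
    let ?S = "?I - {j}"
    have ins: "insert j ?S = ?I" using that by auto
    have "indep_vars (\<lambda>_. borel) X (insert j ?S)" using indep by (simp only: ins)
    then have ind: "indep_var borel (X j) borel (\<lambda>\<omega>. \<Sum>i\<in>?S. X i \<omega>)"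
      using J by (intro indep_vars_sum) auto
    have card: "card ?S = card J" using J that by (simp add: card_insert_if)
    have "prob (?E3 j) = prob ((\<lambda>\<omega>. (X j \<omega>, \<Sum>i\<in>?S. X i \<omega>)) -` ({x<..} \<times> {x<..}) \<inter> space M)"
      by (intro arg_cong[where f = prob]) auto
    also have "\<dots> = prob (X j -` {x<..} \<inter> space M) * prob ((\<lambda>\<omega>. \<Sum>i\<in>?S. X i \<omega>) -` {x<..} \<inter> space M)"
      by (rule indep_varD[OF ind]) auto
    also have "prob (X j -` {x<..} \<inter> space M) = \<P>(\<omega> in M. X j \<omega> > x)"
      by (intro arg_cong[where f = prob]) auto
    also have "\<dots> = conv_tail D (Suc 0) x" using that by (simp add: single)
    also have "prob ((\<lambda>\<omega>. \<Sum>i\<in>?S. X i \<omega>) -` {x<..} \<inter> space M) = \<P>(\<omega> in M. (\<Sum>i\<in>?S. X i \<omega>) > x)"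
      by (intro arg_cong[where f = prob]) auto
    also have "\<dots> = conv_tail D (card J) x"
      using prob_iid_sum_greater[of ?S X D x] indep_vars_subset[OF indep, of ?S] D J card by auto
    finally show ?thesis .
  qed
  then have "(\<Sum>j\<in>J. prob (?E3 j)) = real (card J) * (conv_tail D (Suc 0) x * conv_tail D (card J) x)"
    by simp
  with le show "p \<le> conv_tail D (Suc 0) x + D.excess (Suc (card J)) x + real (card J) * (conv_tail D (Suc 0) x * conv_tail D (card J) x)"
    by simp
qed

section \<open>The blocking probability\<close>

text \<open>
  For a fixed set of present requests the ratio tends to 1 by the first and third bound of
  \<open>prob_truncated_sum_bounds\<close>; the second one, Kesten's bound and the exponential moment of the
  number of present requests dominate the ratio when averaging over the set.
\<close>

lemma (in loss_network) present_load_tail: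
  assumes "subexponential_law D" and D: "\<And>i. distr M borel (B i) = D"
  shows "((\<lambda>C. \<P>(\<omega> in M. B n \<omega> + truncated_sum (\<lambda>i. B i \<omega>) C (present_fin n \<omega>) > C) / conv_tail D (Suc 0) C)
      \<longlongrightarrow> 1) at_top"
proof -
  interpret D: subexponential_law D by fact
  have posB: "AE \<omega> in M. B i \<omega> > 0" for i
    using D.pos unfolding D[of i, symmetric] by (subst (asm) AE_distr_iff) auto
  have indepB: "indep_vars (\<lambda>_. borel) B S" for S
    using requirement_iid by (auto simp: iid_def intro: indep_vars_subset)
  define p where "p C J = \<P>(\<omega> in M. B n \<omega> + truncated_sum (\<lambda>i. B i \<omega>) C J > C)" for C J
  note bounds = prob_truncated_sum_bounds[where n = n, OF _ _ indepB D D.positive_law_axioms posB, folded p_def]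
  obtain \<epsilon> :: real where \<epsilon>: "\<epsilon> > 0" and int: "integrable M (\<lambda>\<omega>. (1 + \<epsilon>) ^ card (present_fin n \<omega>))"
    by (rule present_exponential_moment[of n])
  obtain K where K: "\<And>m x. conv_tail D m x \<le> K * (1 + \<epsilon>) ^ m * conv_tail D (Suc 0) x"
    using D.kesten_bound[OF \<epsilon>] by blast
  have joint: "\<P>(\<omega> in M. B n \<omega> + truncated_sum (\<lambda>i. B i \<omega>) C (present_fin n \<omega>) > C)
      = expectation (\<lambda>\<omega>. p C (present_fin n \<omega>))" for C
  proof -
    have "Measurable.pred (\<Pi>\<^sub>M i\<in>(UNIV :: int set). borel) (\<lambda>b. b n + truncated_sum b C J > C)" for J
      unfolding truncated_sum_def by measurable
    from prob_present_requirements[of "\<lambda>J b. b n + truncated_sum b C J > C", OF this]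
    show ?thesis unfolding p_def by simp
  qed
  have lim: "((\<lambda>C. p C J / conv_tail D (Suc 0) C) \<longlongrightarrow> 1) at_top" if J: "finite J" "n \<notin> J" for J
  proof (rule tendsto_sandwich)
    let ?m = "card J"
    show "eventually (\<lambda>C. 1 \<le> p C J / conv_tail D (Suc 0) C) at_top"
      using bounds(1)[OF J] D.Fc_pos by (intro always_eventually allI) (simp add: pos_le_divide_eq)
    show "eventually (\<lambda>C. p C J / conv_tail D (Suc 0) C
        \<le> 1 + D.excess (Suc ?m) C / conv_tail D (Suc 0) C + real ?m * conv_tail D ?m C) at_top"
    proof (rule always_eventually, rule allI)
      fix C
      have "p C J / conv_tail D (Suc 0) C \<le> (conv_tail D (Suc 0) C + D.excess (Suc ?m) C
          + real ?m * (conv_tail D (Suc 0) C * conv_tail D ?m C)) / conv_tail D (Suc 0) C"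
        using bounds(3)[OF J] D.Fc_pos[of C] by (intro divide_right_mono) auto
      also have "\<dots> = 1 + D.excess (Suc ?m) C / conv_tail D (Suc 0) C + real ?m * conv_tail D ?m C"
        using D.Fc_pos[of C] by (simp add: add_divide_distrib)
      finally show "p C J / conv_tail D (Suc 0) C
        \<le> 1 + D.excess (Suc ?m) C / conv_tail D (Suc 0) C + real ?m * conv_tail D ?m C" .
    qed
    have "((\<lambda>C. (conv_tail D ?m C / conv_tail D (Suc 0) C) * conv_tail D (Suc 0) C) \<longlongrightarrow> real ?m * 0) at_top"
      by (intro tendsto_mult D.conv_tail_ratio_tendsto D.Fc_tendsto_0)
    then have "(conv_tail D ?m \<longlongrightarrow> 0) at_top" using D.Fc_pos by (simp add: less_imp_neq[THEN not_sym])
    then have "((\<lambda>C. 1 + D.excess (Suc ?m) C / conv_tail D (Suc 0) C + real ?m * conv_tail D ?m C)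
        \<longlongrightarrow> 1 + 0 + real ?m * 0) at_top"
      by (intro tendsto_intros D.excess_ratio_tendsto)
    then show "((\<lambda>C. 1 + D.excess (Suc ?m) C / conv_tail D (Suc 0) C + real ?m * conv_tail D ?m C)
        \<longlongrightarrow> 1) at_top" by simp
  qed (rule tendsto_const)
  have meas: "(\<lambda>\<omega>. p C (present_fin n \<omega>) / conv_tail D (Suc 0) C) \<in> borel_measurable M" for C
    by (rule measurable_compose[OF measurable_present_fin]) simp
  have "((\<lambda>C. expectation (\<lambda>\<omega>. p C (present_fin n \<omega>) / conv_tail D (Suc 0) C)) \<longlongrightarrow> expectation (\<lambda>_. 1)) at_top"
  proof (rule integral_dominated_convergence_at_top[OF _ meas])
    show "integrable M (\<lambda>\<omega>. K * (1 + \<epsilon>) * (1 + \<epsilon>) ^ card (present_fin n \<omega>))"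
      by (intro integrable_mult_right int)
    show "AE \<omega> in M. ((\<lambda>C. p C (present_fin n \<omega>) / conv_tail D (Suc 0) C) \<longlongrightarrow> 1) at_top"
      by (intro AE_I2 lim present_fin_properties)
    have "norm (p C J / conv_tail D (Suc 0) C) \<le> K * (1 + \<epsilon>) * (1 + \<epsilon>) ^ card J"
      if "finite J" "n \<notin> J" for C J
    proof -
      have "p C J \<le> K * (1 + \<epsilon>) ^ Suc (card J) * conv_tail D (Suc 0) C"
        using bounds(2)[OF that] K by (rule order_trans)
      moreover have "0 \<le> p C J" by (simp add: p_def)
      ultimately show ?thesis using D.Fc_pos[of C] by (simp add: pos_divide_le_eq mult_ac)
    qed
    then show "eventually (\<lambda>C. AE \<omega> in M. norm (p C (present_fin n \<omega>) / conv_tail D (Suc 0) C)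
        \<le> K * (1 + \<epsilon>) * (1 + \<epsilon>) ^ card (present_fin n \<omega>)) at_top"
      by (intro always_eventually allI AE_I2) (simp add: present_fin_properties)
  qed simp
  then show ?thesis by (simp add: joint prob_space)
qed

theorem theorem1:
  fixes M :: "'a measure"
    and rate :: real
    and \<tau> B \<theta> :: "int \<Rightarrow> 'a \<Rightarrow> real"
    and Q :: "real \<Rightarrow> int \<Rightarrow> 'a \<Rightarrow> real"
    and n :: int
  assumes "loss_network M rate \<tau> B \<theta>"
    and "\<And>n. subexponential (distr M borel (B n))"
    and "\<And>n. integrable M (B n)"
    and "\<And>C. C > 0 \<Longrightarrow> loss_network.stationary_regime M \<tau> B \<theta> C (Q C)"
  shows "(\<lambda>C. \<P>(\<omega> in M. Q C n \<omega> + B n \<omega> > C)) \<sim>[at_top] (\<lambda>C. \<P>(\<omega> in M. B 0 \<omega> > C))"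
proof -
  interpret loss_network M rate \<tau> B \<theta> by fact
  define D where "D = distr M borel (B 0)"
  have D: "distr M borel (B i) = D" for i using requirement_iid unfolding iid_def D_def by metis
  interpret D: subexponential_law D unfolding D_def by (intro subexponential_lawI assms)
  have tail: "\<P>(\<omega> in M. B i \<omega> > C) = conv_tail D (Suc 0) C" for i C
    using prob_iid_sum_greater[of "{i}" B D C] D requirement_iid
    by (simp add: iid_def indep_vars_subset[of _ _ UNIV])
  have "AE \<omega> in M. B i \<omega> > 0" for i
    using D.pos unfolding D[of i, symmetric] by (subst (asm) AE_distr_iff) auto
  then have posB: "AE \<omega> in M. \<forall>i. B i \<omega> > 0" by (simp add: AE_all_countable)
  let ?R = "\<lambda>C \<omega>. truncated_sum (\<lambda>i. B i \<omega>) C (present_fin n \<omega>)"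
  have meas_R: "Measurable.pred M (\<lambda>\<omega>. B n \<omega> + ?R C \<omega> > C)" for C
  proof -
    have "(\<lambda>\<omega>. ?R C \<omega>) \<in> borel_measurable M"
      by (rule measurable_compose_countable'[OF _ measurable_present_fin countable_Collect_finite])
         (unfold truncated_sum_def, measurable)
    then show ?thesis by measurable
  qed
  \<comment> \<open>Accepted requests need at most \<open>C\<close>, so the engaged amount is at most the truncated sum over
    all present requests.\<close>
  have bounds: "conv_tail D (Suc 0) C \<le> \<P>(\<omega> in M. Q C n \<omega> + B n \<omega> > C)"
    "\<P>(\<omega> in M. Q C n \<omega> + B n \<omega> > C) \<le> \<P>(\<omega> in M. B n \<omega> + ?R C \<omega> > C)" if "C > 0" for C
  proof -
    have [measurable]: "random_variable borel (Q C k)" for k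
      using assms(4)[OF that] by (simp add: stationary_regime_def stationary_def)
    have "AE \<omega> in M. 0 \<le> Q C n \<omega> \<and> Q C n \<omega> \<le> ?R C \<omega>"
      using assms(4)[OF that, unfolded stationary_regime_def, THEN conjunct2] posB finite_present[of n]
    proof eventually_elim
      case (elim \<omega>)
      have nonneg: "0 \<le> Q C k \<omega>" for k
        using elim(1,2) by (simp add: sum_nonneg less_imp_le)
      have sub: "active C (Q C) n \<omega> \<subseteq> present_fin n \<omega>"
        using elim(3) by (auto simp: active_def present_fin_def present_def overlaps_def elapsed_eq)
      have le_C: "B i \<omega> \<le> C" if "i \<in> active C (Q C) n \<omega>" for i
        using that nonneg[of i] by (simp add: active_def)
      have "Q C n \<omega> = (\<Sum>i\<in>active C (Q C) n \<omega>. if B i \<omega> \<le> C then B i \<omega> else 0)"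
        using elim(1) le_C by simp
      also have "\<dots> \<le> ?R C \<omega>"
        unfolding truncated_sum_def using sub elim(2)
        by (intro sum_mono2) (auto simp: present_fin_properties less_imp_le)
      finally show ?case using nonneg by simp
    qed
    then have AE: "AE \<omega> in M. 0 \<le> Q C n \<omega>" "AE \<omega> in M. Q C n \<omega> \<le> ?R C \<omega>" by auto
    show "conv_tail D (Suc 0) C \<le> \<P>(\<omega> in M. Q C n \<omega> + B n \<omega> > C)"
      unfolding tail[of C n, symmetric] using AE(1) by (intro finite_measure_mono_AE) auto
    show "\<P>(\<omega> in M. Q C n \<omega> + B n \<omega> > C) \<le> \<P>(\<omega> in M. B n \<omega> + ?R C \<omega> > C)"
      using AE(2) meas_R by (intro finite_measure_mono_AE) auto
  qed
  have "((\<lambda>C. \<P>(\<omega> in M. Q C n \<omega> + B n \<omega> > C) / conv_tail D (Suc 0) C) \<longlongrightarrow> 1) at_top"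
  proof (rule tendsto_sandwich)
    show "eventually (\<lambda>C. 1 \<le> \<P>(\<omega> in M. Q C n \<omega> + B n \<omega> > C) / conv_tail D (Suc 0) C) at_top"
      using eventually_gt_at_top[of 0]
      by eventually_elim (use bounds(1) D.Fc_pos in \<open>simp add: pos_le_divide_eq\<close>)
    show "eventually (\<lambda>C. \<P>(\<omega> in M. Q C n \<omega> + B n \<omega> > C) / conv_tail D (Suc 0) C
        \<le> \<P>(\<omega> in M. B n \<omega> + ?R C \<omega> > C) / conv_tail D (Suc 0) C) at_top"
      using eventually_gt_at_top[of 0]
      by eventually_elim (intro divide_right_mono bounds(2) D.conv_tail_nonneg)
    show "((\<lambda>C. \<P>(\<omega> in M. B n \<omega> + ?R C \<omega> > C) / conv_tail D (Suc 0) C) \<longlongrightarrow> 1) at_top"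
      by (rule present_load_tail[OF D.subexponential_law_axioms D])
  qed (rule tendsto_const)
  then show ?thesis by (intro asymp_equivI') (simp add: tail)
qed

end
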